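(* Let $0<\alpha\le 2$ and $K>0$. For any $\varepsilon\in(0,1)$ there exist constants $C_1,C_2,C_3,C_4>0$ depending only on $\alpha$, $K$ and $\varepsilon$ such that, for all integers $n\ge 2$, $p\ge1$ and $s\in[p]$, the test $$\phi_{\mathcal{G},\mathrm{sparse}}:=\mathbf{1}\Bigl\{\max_{t\in\mathcal{T}\setminus\{1\}}A_{t,a}>r\Bigr\}\vee\mathbf{1}\{A_{1,a}>r_1\}$$ with $$a=C_1\bigl[\log^{1/\alpha}(ep/s)+s^{-1/2}\log^{1/2}\{\log(8n)\}\bigr],\quad r=C_2\bigl(\sqrt{s\log\log(8n)}+\log\log(8n)\bigr),\quad r_1=C_3\,s\log^{2/\alpha}(ep/s)$$ satisfies $\mathcal{R}_{\mathcal{G}}(\rho,\phi_{\mathcal{G},\mathrm{sparse}})\le\varepsilon$ as long as $$\rho^2\ge C_4\bigl(s\log^{2/\alpha}(ep/s)+\log\log(8n)\bigr).$$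
   Context: Notation: $[m]=\{1,\dots,m\}$; $x\vee y=\max(x,y)$; $\log$ is the natural logarithm; $\|v\|_0$ is the number of nonzero entries of $v$. A maximum over an empty set does not trigger rejection. Model: $X=\theta+E\in\mathbb{R}^{p\times n}$, with deterministic $\theta$ and random $E\sim P_e$; $X_t,\theta_t,E_t\in\mathbb{R}^p$ denote the $t$-th columns and $X_t(j)$ the $j$-th entry of $X_t$. $\mathbb{E}_{\theta,P_e}$ is expectation under the law of $X$. Null space: $\Theta_0(p,n)=\{\theta:\exists\mu\in\mathbb{R}^p,\ \theta_t=\mu\ \forall t\in[n]\}$. For $t_0\in[n-1]$, $\Theta^{(t_0)}(p,n,s,\rho)$ is the set of $\theta$ for which there are $\mu_1,\mu_2\in\mathbb{R}^p$ with $\theta_t=\mu_1$ for $t\le t_0$, $\theta_t=\mu_2$ for $t>t_0$, $\|\mu_1-\mu_2\|_0\le s$ and $\frac{t_0(n-t_0)}{n}\|\mu_1-\mu_2\|_2^2\ge\rho^2$. Alternative space: $\Theta(p,n,s,\rho)=\bigcup_{t_0=1}^{n-1}\Theta^{(t_0)}(p,n,s,\rho)$. Noise class: $\mathcal{G}_{\alpha,K}$ is the class of distributions of real random variables $W$ with $\mathbb{E}W=0$, $\mathbb{E}W^2=1$, $\mathbb{E}\exp(|W/K|^\alpha)\le 2$. $\mathcal{G}_{\alpha,K}^{\otimes}$ is the class of joint distributions of $E$ with mutually independent entries, each entry having a (possibly different) distribution in $\mathcal{G}_{\alpha,K}$. Worst-case testing error of a measurable test $\phi:\mathbb{R}^{p\times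 n}\to\{0,1\}$: $$\mathcal{R}_{\mathcal{G}}(\rho,\phi)=\sup_{P_e\in\mathcal{G}_{\alpha,K}^{\otimes}}\sup_{\theta\in\Theta_0(p,n)}\mathbb{E}_{\theta,P_e}(\phi)+\sup_{P_e\in\mathcal{G}_{\alpha,K}^{\otimes}}\sup_{\theta\in\Theta(p,n,s,\rho)}\mathbb{E}_{\theta,P_e}(1-\phi).$$ Test statistics: $\mathcal{T}=\{1,2,4,\dots,2^{\lfloor\log_2(n/2)\rfloor}\}$; $Y_t=\frac{\sum_{i=1}^tX_i-\sum_{i=1}^tX_{n+1-i}}{\sqrt{2t}}$; for $t\in\mathcal{T}\setminus\{1\}$, $$Y_{t,1}=\frac{\sum_{i=1}^{t/2}X_{2i-1}-\sum_{i=1}^{t/2}X_{n+2-2i}}{\sqrt t},\qquad Y_{t,2}=\frac{\sum_{i=1}^{t/2}X_{2i}-\sum_{i=1}^{t/2}X_{n+1-2i}}{\sqrt t};$$ $A_{t,a}=\sum_{j=1}^p\{Y_{t,1}^2(j)-1\}\mathbf{1}\{|Y_{t,2}(j)|\ge a\}$ for $t\ge2$, and $A_{1,a}=\sum_{j=1}^p\{Y_1^2(j)-1\}\mathbf{1}\{|Y_1(j)|\ge a\}$. *)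

theory Defs
  imports "HOL-Probability.Probability"
begin

text \<open>
  A real p-by-n matrix is an extensional function on pairs (j, t), where j is the row (coordinate)
  and t the column (time), both counted from 1. A vector of length p is a function on nat of
  which only the values at 1, ..., p matter. Since p and n are quantified inside the
  main statement, they are explicit parameters and not types.
\<close>

definition cells :: "nat \<Rightarrow> nat \<Rightarrow> (nat \<times> nat) set" where
  "cells p n = {1..p} \<times> {1..n}"

abbreviation matrix_space :: "nat \<Rightarrow> nat \<Rightarrow> (nat \<times> nat \<Rightarrow> real) measure" where
  "matrix_space p n \<equiv> PiM (cells p n) (\<lambda>_. borel)"

definition null_params :: "nat \<Rightarrow> nat \<Rightarrow> (nat \<times> nat \<Rightarrow> real) set" where
  "null_params p n =
     {\<theta> \<in> space (matrix_space p n).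
        \<exists>\<mu>::nat \<Rightarrow> real. \<forall>t\<in>{1..n}. \<forall>j\<in>{1..p}. \<theta> (j, t) = \<mu> j}"

definition l0_norm :: "nat \<Rightarrow> (nat \<Rightarrow> real) \<Rightarrow> nat" where
  "l0_norm p v = card {j \<in> {1..p}. v j \<noteq> 0}"

definition alt_params_at ::
    "nat \<Rightarrow> nat \<Rightarrow> nat \<Rightarrow> nat \<Rightarrow> real \<Rightarrow> (nat \<times> nat \<Rightarrow> real) set" where
  "alt_params_at t0 p n s \<rho> =
     {\<theta> \<in> space (matrix_space p n).
        \<exists>\<mu>1 \<mu>2 :: nat \<Rightarrow> real.
          (\<forall>t\<in>{1..n}. \<forall>j\<in>{1..p}. \<theta> (j, t) = (if t \<le> t0 then \<mu>1 j else \<mu>2 j)) \<and>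
          l0_norm p (\<lambda>j. \<mu>1 j - \<mu>2 j) \<le> s \<and>
          real t0 * (real n - real t0) / real n * (L2_set (\<lambda>j. \<mu>1 j - \<mu>2 j) {1..p})\<^sup>2 \<ge> \<rho>\<^sup>2}"

definition alt_params ::
    "nat \<Rightarrow> nat \<Rightarrow> nat \<Rightarrow> real \<Rightarrow> (nat \<times> nat \<Rightarrow> real) set" where
  "alt_params p n s \<rho> = (\<Union>t0\<in>{1..n - 1}. alt_params_at t0 p n s \<rho>)"

text \<open>
  The exponential moment is a nonnegative integral, so that the bound includes finiteness; the
  explicit integrability conditions exclude the convention that the Bochner integral of a
  non-integrable function is 0.
\<close>

definition noise_dists :: "real \<Rightarrow> real \<Rightarrow> real measure set" where
  "noise_dists \<alpha> K =
     {D. prob_space D \<and> sets D = sets borel \<and>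
         integrable D (\<lambda>w. w) \<and> (\<integral>w. w \<partial>D) = 0 \<and>
         integrable D (\<lambda>w. w\<^sup>2) \<and> (\<integral>w. w\<^sup>2 \<partial>D) = 1 \<and>
         (\<integral>\<^sup>+w. ennreal (exp (\<bar>w / K\<bar> powr \<alpha>)) \<partial>D) \<le> 2}"

definition noise_laws ::
    "real \<Rightarrow> real \<Rightarrow> nat \<Rightarrow> nat \<Rightarrow> (nat \<times> nat \<Rightarrow> real) measure set" where
  "noise_laws \<alpha> K p n =
     {P. prob_space P \<and> sets P = sets (matrix_space p n) \<and>
         prob_space.indep_vars P (\<lambda>_. borel) (\<lambda>i E. E i) (cells p n) \<and>
         (\<forall>i\<in>cells p n. distr P borel (\<lambda>E. E i) \<in> noise_dists \<alpha> K)}"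

definition data_law ::
    "nat \<Rightarrow> nat \<Rightarrow> (nat \<times> nat \<Rightarrow> real) \<Rightarrow> (nat \<times> nat \<Rightarrow> real) measure
      \<Rightarrow> (nat \<times> nat \<Rightarrow> real) measure" where
  "data_law p n \<theta> P = distr P (matrix_space p n) (\<lambda>E. \<lambda>i\<in>cells p n. \<theta> i + E i)"

text \<open>
  Suprema and expectations are taken in the extended nonnegative reals, where the supremum over
  an empty noise class (which occurs for small K) is 0. The definition is meant for measurable tests.
\<close>

definition testing_error ::
    "real \<Rightarrow> real \<Rightarrow> nat \<Rightarrow> nat \<Rightarrow> nat \<Rightarrow> real \<Rightarrow> ((nat \<times> nat \<Rightarrow> real) \<Rightarrow> real) \<Rightarrow> ennreal" where
  "testing_error \<alpha> K p n s \<rho> \<phi> =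
     (SUP P\<in>noise_laws \<alpha> K p n. SUP \<theta>\<in>null_params p n.
        \<integral>\<^sup>+X. ennreal (\<phi> X) \<partial>data_law p n \<theta> P) +
     (SUP P\<in>noise_laws \<alpha> K p n. SUP \<theta>\<in>alt_params p n s \<rho>.
        \<integral>\<^sup>+X. ennreal (1 - \<phi> X) \<partial>data_law p n \<theta> P)"

definition grid :: "nat \<Rightarrow> nat set" where
  "grid n = {2 ^ k |k::nat. int k \<le> \<lfloor>log 2 (real n / 2)\<rfloor>}"

definition Y :: "nat \<Rightarrow> (nat \<times> nat \<Rightarrow> real) \<Rightarrow> nat \<Rightarrow> nat \<Rightarrow> real" where
  "Y n X t j = ((\<Sum>i=1..t. X (j, i)) - (\<Sum>i=1..t. X (j, n + 1 - i))) / sqrt (2 * real t)"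

definition Y1 :: "nat \<Rightarrow> (nat \<times> nat \<Rightarrow> real) \<Rightarrow> nat \<Rightarrow> nat \<Rightarrow> real" where
  "Y1 n X t j =
     ((\<Sum>i=1..t div 2. X (j, 2 * i - 1)) - (\<Sum>i=1..t div 2. X (j, n + 2 - 2 * i))) / sqrt (real t)"

definition Y2 :: "nat \<Rightarrow> (nat \<times> nat \<Rightarrow> real) \<Rightarrow> nat \<Rightarrow> nat \<Rightarrow> real" where
  "Y2 n X t j =
     ((\<Sum>i=1..t div 2. X (j, 2 * i)) - (\<Sum>i=1..t div 2. X (j, n + 1 - 2 * i))) / sqrt (real t)"

definition A :: "nat \<Rightarrow> nat \<Rightarrow> (nat \<times> nat \<Rightarrow> real) \<Rightarrow> nat \<Rightarrow> real \<Rightarrow> real" where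
  "A p n X t a =
     (if t = 1 then \<Sum>j=1..p. ((Y n X 1 j)\<^sup>2 - 1) * of_bool (\<bar>Y n X 1 j\<bar> \<ge> a)
      else \<Sum>j=1..p. ((Y1 n X t j)\<^sup>2 - 1) * of_bool (\<bar>Y2 n X t j\<bar> \<ge> a))"

text \<open>A maximum over an empty set does not lead to rejection.\<close>

definition sparse_test ::
    "nat \<Rightarrow> nat \<Rightarrow> real \<Rightarrow> real \<Rightarrow> real \<Rightarrow> (nat \<times> nat \<Rightarrow> real) \<Rightarrow> real" where
  "sparse_test p n a r r1 X =
     max (of_bool (grid n - {1} \<noteq> {} \<and> Max ((\<lambda>t. A p n X t a) ` (grid n - {1})) > r))
         (of_bool (A p n X 1 a > r1))"

lemma finite_grid: "finite (grid n)"
proof -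
  have "grid n \<subseteq> (\<lambda>k. 2 ^ k) ` {..nat \<lfloor>log 2 (real n / 2)\<rfloor>}"
    by (auto simp: grid_def le_nat_iff)
  then show ?thesis
    by (rule finite_subset) simp
qed

lemma grid_bounds:
  assumes "n \<ge> 2" "t \<in> grid n"
  shows "1 \<le> t" "2 * t \<le> n"
proof -
  from assms(2) obtain k :: nat where k: "t = 2 ^ k" "int k \<le> \<lfloor>log 2 (real n / 2)\<rfloor>"
    by (auto simp: grid_def)
  then have "real k \<le> log 2 (real n / 2)"
    by linarith
  then have "2 powr real k \<le> real n / 2"
    using assms(1) by (subst (asm) le_log_iff) auto
  then have "real (2 * t) \<le> real n"
    by (simp add: k powr_realpow)
  then show "2 * t \<le> n"
    by (simp only: of_nat_le_iff)
  show "1 \<le> t"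
    by (simp add: k)
qed

lemma entry_measurable:
  "i \<in> cells p n \<Longrightarrow> (\<lambda>X. X i) \<in> borel_measurable (matrix_space p n)"
  by (rule measurable_component_singleton)

lemma A_measurable:
  assumes "n \<ge> 2" "t \<in> grid n"
  shows "(\<lambda>X. A p n X t a) \<in> borel_measurable (matrix_space p n)"
proof -
  note b = grid_bounds[OF assms]
  have Y: "(\<lambda>X. Y n X t j) \<in> borel_measurable (matrix_space p n)" if "j \<in> {1..p}" for j
    unfolding Y_def using b that
    by (intro borel_measurable_divide borel_measurable_diff borel_measurable_sum
          borel_measurable_const entry_measurable) (auto simp: cells_def)
  have Y1: "(\<lambda>X. Y1 n X t j) \<in> borel_measurable (matrix_space p n)" if "j \<in> {1..p}" for j
    unfolding Y1_def using b that
    by (intro borel_measurable_divide borel_measurable_diff borel_measurable_sum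
          borel_measurable_const entry_measurable) (auto simp: cells_def)
  have Y2: "(\<lambda>X. Y2 n X t j) \<in> borel_measurable (matrix_space p n)" if "j \<in> {1..p}" for j
    unfolding Y2_def using b that
    by (intro borel_measurable_divide borel_measurable_diff borel_measurable_sum
          borel_measurable_const entry_measurable) (auto simp: cells_def)
  have summand: "(\<lambda>X. ((f X)\<^sup>2 - 1) * of_bool (a \<le> \<bar>g X\<bar>)) \<in> borel_measurable (matrix_space p n)"
    if [measurable]: "f \<in> borel_measurable (matrix_space p n)"
      "g \<in> borel_measurable (matrix_space p n)" for f g :: "_ \<Rightarrow> real"
    unfolding of_bool_def by measurable
  show ?thesis
  proof (cases "t = 1")
    case True
    then show ?thesis
      unfolding A_def by (simp only: if_True refl) (intro borel_measurable_sum summand Y[unfolded True])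
  next
    case False
    then show ?thesis
      unfolding A_def by (simp only: if_False) (intro borel_measurable_sum summand Y1 Y2)
  qed
qed

lemma sparse_test_measurable:
  assumes "n \<ge> 2"
  shows "sparse_test p n a r r1 \<in> borel_measurable (matrix_space p n)"
proof -
  have "1 \<in> grid n"
    using assms by (auto simp: grid_def intro!: exI[of _ 0])
  then have [measurable]: "(\<lambda>X. A p n X 1 a) \<in> borel_measurable (matrix_space p n)"
    by (rule A_measurable[OF assms])
  have [measurable]: "Measurable.pred (matrix_space p n) (\<lambda>X. \<exists>t\<in>grid n - {1}. r < A p n X t a)"
  proof (rule pred_intros_finite(4))
    show "finite (grid n - {1})"
      using finite_grid by simp
    show "Measurable.pred (matrix_space p n) (\<lambda>X. r < A p n X t a)" if "t \<in> grid n - {1}" for t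
    proof -
      have [measurable]: "(\<lambda>X. A p n X t a) \<in> borel_measurable (matrix_space p n)"
        using that by (intro A_measurable[OF assms]) simp
      show ?thesis by measurable
    qed
  qed
  have "(grid n - {1} \<noteq> {} \<and> Max ((\<lambda>t. A p n X t a) ` (grid n - {1})) > r)
      \<longleftrightarrow> (\<exists>t\<in>grid n - {1}. r < A p n X t a)" for X
    using finite_grid[of n] by (cases "grid n - {1} = {}") (auto simp: Max_gr_iff)
  then have "sparse_test p n a r r1 = (\<lambda>X. max (of_bool (\<exists>t\<in>grid n - {1}. r < A p n X t a))
      (of_bool (r1 < A p n X 1 a)))"
    by (simp add: sparse_test_def fun_eq_iff)
  also have "\<dots> \<in> borel_measurable (matrix_space p n)"
    unfolding of_bool_def by measurable
  finally show ?thesis .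
qed

end

(* Differences of the columns c and n + 1 - c form an independent array, and all statistics are
   normalised sums over disjoint parts of its rows. The entries have only stretched exponential tails,
   so no Laplace transforms are used. Instead, the even moments of a sum of independent variables are
   bounded by a Cauchy estimate on the (truncated) exponential generating function of moments. The
   estimate is applied three times. Applied to all t it gives moments (C m^(1/alpha))^(2m), hence
   P(|Y_{t,2}(j)| >= a) <= (s/p)^2. Applied to t polynomially large in log log n it gives Gaussian
   moments (C sqrt m)^(2m). Applied to the sum over the coordinates j it then gives
   P(A_{t,a} > r) <= eta/log(8n) for such t. Only O(log log n) dyadic t are smaller, and Chebyshev's
   inequality suffices for them. Under the alternative, a largest dyadic t not exceeding t_0 and n - t_0
   captures the signal, and a pointwise lower bound for A_{t,a} with Markov's inequality for the
   remainder finishes the proof. *)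

theory Submission
  imports Defs
begin

section \<open>Moments of sums of independent variables\<close>

text \<open>The moment bound valid at every t is too weak for the threshold r: for
  \<open>\<alpha> < 2\<close> it lets the k-th moment of a squared statistic grow faster than
  \<open>k!\<close>. Gaussian moments restore the growth \<open>C^k k!\<close>, and only orders up
  to a multiple of \<open>log log(8n)\<close> are needed, which is why t polynomial in
  \<open>log log(8n)\<close> already counts as large. At a smaller scale Chebyshev costs a constant
  over \<open>C2^2 log log(8n)\<close>; the number of such scales cancels
  \<open>log log(8n)\<close>, and C2 makes the total small. The halves \<open>Y_{t,1}\<close> and
  \<open>Y_{t,2}\<close> are independent, so a summand of \<open>A_{t,a}\<close> is centred under
  the null and its moments carry the whole tail probability as a factor. At t = 1 there is no such
  split: the summand may have a mean, only a first-moment bound is used, and this explains the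
  separate threshold r1. The tail level is \<open>(s/p)^2\<close> and not \<open>s/p\<close> because
  the bound on the absolute first moment takes its square root, and \<open>s/p\<close> per
  coordinate adds up to s.\<close>

lemma power_over_fact_le_exp:
  fixes x :: real
  assumes "x \<ge> 0"
  shows "x ^ k / fact k \<le> exp x"
proof -
  have s: "(\<lambda>n. x ^ n /\<^sub>R fact n) sums exp x"
    by (rule exp_converges)
  have "x ^ k /\<^sub>R fact k = (\<Sum>n\<in>{k}. x ^ n /\<^sub>R fact n)"
    by simp
  also have "\<dots> \<le> suminf (\<lambda>n. x ^ n /\<^sub>R fact n)"
    using assms s by (intro sum_le_suminf) (auto simp: sums_iff)
  also have "\<dots> = exp x"
    using s by (simp add: sums_iff)
  finally show ?thesis
    by (simp add: field_simps)
qed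

text \<open>One term of the exponential series at k. It is the half of Stirling's formula that
  trades \<open>k ^ k\<close> for \<open>k!\<close> at the price of a constant to the power
  k.\<close>

lemma power_self_le_exp_fact: "real k ^ k \<le> exp (real k) * fact k"
  using power_over_fact_le_exp[of "real k" k] by (simp add: field_simps)

lemma fact_le_power_self: "(fact k :: real) \<le> real k ^ k"
  using fact_le_power[of k, where ?'a = nat] by (metis of_nat_fact of_nat_le_iff of_nat_power)

text \<open>\<open>ln x <= x\<close> at \<open>x = u / b\<close>, exponentiated. With
  \<open>b = k / \<alpha>\<close> it turns the exponential moment of the noise into power
  moments.\<close>

lemma powr_self_bound:
  fixes u b :: real
  assumes "u \<ge> 0" "b > 0"
  shows "u powr b \<le> b powr b * exp u"
proof (cases "u = 0")
  case False
  have "ln (u / b) \<le> u / b"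
    using False assms ln_bound[of "u / b"] by simp
  then have "b * ln (u / b) \<le> u"
    using assms by (simp add: field_simps)
  then have "b * ln u \<le> b * ln b + u"
    using assms False by (simp add: ln_div algebra_simps)
  then show ?thesis
    using assms False by (simp add: powr_def flip: exp_add)
qed (use assms in auto)

context prob_space
begin

lemma indep_var_power_integral:
  fixes X Y :: "'a \<Rightarrow> real"
  assumes "indep_var borel X borel Y"
    and "\<And>k. integrable M (\<lambda>w. X w ^ k)" "\<And>k. integrable M (\<lambda>w. Y w ^ k)"
  shows "integrable M (\<lambda>w. X w ^ i * Y w ^ j)"
    and "expectation (\<lambda>w. X w ^ i * Y w ^ j) = expectation (\<lambda>w. X w ^ i) * expectation (\<lambda>w. Y w ^ j)"
proof -
  have *: "indep_var borel (\<lambda>w. X w ^ i) borel (\<lambda>w. Y w ^ j)"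
    by (rule indep_var_compose[OF assms(1), of "\<lambda>x. x ^ i" borel "\<lambda>x. x ^ j" borel, unfolded comp_def]) auto
  show "integrable M (\<lambda>w. X w ^ i * Y w ^ j)"
    using indep_var_integrable[OF * assms(2,3)] .
  show "expectation (\<lambda>w. X w ^ i * Y w ^ j) = expectation (\<lambda>w. X w ^ i) * expectation (\<lambda>w. Y w ^ j)"
    using indep_var_lebesgue_integral[OF * assms(2,3)] .
qed

text \<open>
  The products \<open>F i\<close> dominate the coefficients of the exponential generating function of the
  moments, as in Cauchy's estimate at radius \<open>z\<close>. No exponential moment is needed, because only the
  moments up to order \<open>m\<close> enter.
\<close>

lemma indep_sum_moment:
  fixes X :: "'i \<Rightarrow> 'a \<Rightarrow> real"
  assumes "finite I" "indep_vars (\<lambda>_. borel) X I"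
    and "\<And>i k. i \<in> I \<Longrightarrow> integrable M (\<lambda>w. X i w ^ k)"
    and "z > 0" "\<And>i. i \<in> I \<Longrightarrow> (\<Sum>j\<le>m. z ^ j * \<bar>expectation (\<lambda>w. X i w ^ j)\<bar> / fact j) \<le> F i"
  shows "(\<forall>k. integrable M (\<lambda>w. (\<Sum>i\<in>I. X i w) ^ k)) \<and>
    (\<forall>k\<le>m. \<bar>expectation (\<lambda>w. (\<Sum>i\<in>I. X i w) ^ k)\<bar> \<le> fact k / z ^ k * prod F I)"
  using assms(1,2,3,5)
proof (induction I)
  case empty
  show ?case
  proof (intro conjI allI impI)
    fix k assume "k \<le> m"
    show "\<bar>expectation (\<lambda>w. (\<Sum>i\<in>{}. X i w) ^ k)\<bar> \<le> fact k / z ^ k * prod F {}"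
      using \<open>z > 0\<close> by (cases k) (simp_all add: prob_space)
  qed simp
next
  case (insert i I)
  define S where "S w = (\<Sum>i\<in>I. X i w)" for w
  have ind: "indep_var borel (X i) borel S"
    using indep_vars_sum[OF insert.hyps insert.prems(1)] unfolding S_def .
  have "indep_vars (\<lambda>_. borel) X I"
    using insert.prems(1) by (rule indep_vars_subset) auto
  then have IH: "\<And>k. integrable M (\<lambda>w. S w ^ k)"
      "\<And>k. k \<le> m \<Longrightarrow> \<bar>expectation (\<lambda>w. S w ^ k)\<bar> \<le> fact k / z ^ k * prod F I"
    using insert.IH insert.prems by (auto simp: S_def)
  have iX: "\<And>k. integrable M (\<lambda>w. X i w ^ k)"
    using insert.prems by simp
  note * = indep_var_power_integral[OF ind iX IH(1)]
  have exp: "(\<Sum>i\<in>insert i I. X i w) ^ k = (\<Sum>j\<le>k. real (k choose j) * (X i w ^ j * S w ^ (k - j)))" for w k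
    using insert.hyps by (simp add: S_def binomial_ring mult.assoc)
  have F0: "0 \<le> prod F I"
  proof (rule prod_nonneg)
    fix i' assume "i' \<in> I"
    have "0 \<le> (\<Sum>j\<le>m. z ^ j * \<bar>expectation (\<lambda>w. X i' w ^ j)\<bar> / fact j)"
      using \<open>z > 0\<close> by (intro sum_nonneg) auto
    then show "0 \<le> F i'"
      using insert.prems(3)[of i'] \<open>i' \<in> I\<close> by simp
  qed
  show ?case
  proof (intro conjI allI impI)
    fix k
    show "integrable M (\<lambda>w. (\<Sum>i\<in>insert i I. X i w) ^ k)"
      unfolding exp using *(1) by (intro Bochner_Integration.integrable_sum integrable_mult_right)
  next
    fix k assume k: "k \<le> m"
    have "\<bar>expectation (\<lambda>w. (\<Sum>i\<in>insert i I. X i w) ^ k)\<bar> =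
        \<bar>\<Sum>j\<le>k. real (k choose j) * (expectation (\<lambda>w. X i w ^ j) * expectation (\<lambda>w. S w ^ (k - j)))\<bar>"
      unfolding exp using *
      by (subst Bochner_Integration.integral_sum) (auto intro!: integrable_mult_right)
    also have "\<dots> \<le> (\<Sum>j\<le>k. real (k choose j) *
        (\<bar>expectation (\<lambda>w. X i w ^ j)\<bar> * (fact (k - j) / z ^ (k - j) * prod F I)))"
    proof (rule order_trans[OF sum_abs], rule sum_mono)
      fix j assume "j \<in> {..k}"
      then have "\<bar>expectation (\<lambda>w. S w ^ (k - j))\<bar> \<le> fact (k - j) / z ^ (k - j) * prod F I"
        using k IH(2)[of "k - j"] by simp
      then show "\<bar>real (k choose j) * (expectation (\<lambda>w. X i w ^ j) * expectation (\<lambda>w. S w ^ (k - j)))\<bar>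
          \<le> real (k choose j) * (\<bar>expectation (\<lambda>w. X i w ^ j)\<bar> * (fact (k - j) / z ^ (k - j) * prod F I))"
        unfolding abs_mult abs_of_nat by (intro mult_left_mono) auto
    qed
    \<comment> \<open>\<open>(k choose j) * fact (k - j) = fact k / fact j\<close> undoes the
      binomial convolution, and \<open>z ^ k\<close> splits in the same way, so the new variable
      enters only through its own truncated series.\<close>
    also have "\<dots> = fact k / z ^ k * prod F I *
        (\<Sum>j\<le>k. z ^ j * \<bar>expectation (\<lambda>w. X i w ^ j)\<bar> / fact j)"
      unfolding sum_distrib_left
    proof (rule sum.cong[OF refl])
      fix j assume j: "j \<in> {..k}"
      then have "real (k choose j) = fact k / (fact j * fact (k - j))"
        by (simp add: binomial_fact)
      moreover have "z ^ k = z ^ j * z ^ (k - j)"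
        using j by (simp flip: power_add)
      ultimately show "real (k choose j) * (\<bar>expectation (\<lambda>w. X i w ^ j)\<bar> * (fact (k - j) / z ^ (k - j) * prod F I))
          = fact k / z ^ k * prod F I * (z ^ j * \<bar>expectation (\<lambda>w. X i w ^ j)\<bar> / fact j)"
        using \<open>z > 0\<close> by (simp add: mult_ac)
    qed
    also have "\<dots> \<le> fact k / z ^ k * prod F I * F i"
    proof (rule mult_left_mono)
      have "(\<Sum>j\<le>k. z ^ j * \<bar>expectation (\<lambda>w. X i w ^ j)\<bar> / fact j)
          \<le> (\<Sum>j\<le>m. z ^ j * \<bar>expectation (\<lambda>w. X i w ^ j)\<bar> / fact j)"
        using k \<open>z > 0\<close> by (intro sum_mono2) auto
      then show "(\<Sum>j\<le>k. z ^ j * \<bar>expectation (\<lambda>w. X i w ^ j)\<bar> / fact j) \<le> F i"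
        using insert.prems(3)[of i] by simp
    qed (use F0 \<open>z > 0\<close> in auto)
    also have "\<dots> = fact k / z ^ k * prod F (insert i I)"
      using insert.hyps by simp
    finally show "\<bar>expectation (\<lambda>w. (\<Sum>i\<in>insert i I. X i w) ^ k)\<bar> \<le> fact k / z ^ k * prod F (insert i I)" .
  qed
qed

end

section \<open>Even moments of independent sums in the stretched exponential and the Gaussian
  regime\<close>

lemma sum_half_powers_le: "(\<Sum>j=2..n. (1 / 2 :: real) ^ (j - 2)) \<le> 2"
proof -
  have "(\<Sum>j=2..n. (1 / 2 :: real) ^ (j - 2)) \<le> 2 - (1 / 2) ^ (n - 2)" if "n \<ge> 2"
    using that
  proof (induction n rule: dec_induct)
    case (step n)
    then have "Suc n - 2 = Suc (n - 2)" by simp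
    with step show ?case by simp
  qed simp
  then show ?thesis
    by (cases "n \<ge> 2") (auto intro: order_trans[of _ "2 - (1 / 2) ^ (n - 2)"])
qed

text \<open>Two factors of each term supply \<open>v / j\<close>. The other \<open>j - 2\<close> are
  written as \<open>1/2 * sqrt (4 v / j)\<close>: the halves sum geometrically, and
  \<open>sqrt x <= exp (x / 2)\<close> bounds the rest by \<open>exp (2 v)\<close> uniformly in
  j.\<close>

lemma stretched_series_bound:
  fixes v :: real
  assumes "v \<ge> 0"
  shows "(\<Sum>j=2..n. sqrt (v / real j) ^ j) \<le> v * exp (2 * v)"
proof -
  have "sqrt (v / real j) ^ j \<le> v / 2 * exp (2 * v) * (1 / 2) ^ (j - 2)" if j: "j \<ge> 2" for j
  proof -
    define x where "x = 4 * v / real j"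
    have x0: "x \<ge> 0" using assms by (simp add: x_def)
    have "sqrt x \<le> sqrt (exp x)"
      using exp_ge_add_one_self[of x] by (intro real_sqrt_le_mono) linarith
    also have "\<dots> = exp (x / 2)"
      by (rule real_sqrt_unique) (simp_all add: power2_eq_square flip: exp_add)
    finally have "sqrt x ^ (j - 2) \<le> exp (x / 2) ^ (j - 2)"
      using x0 by (intro power_mono) auto
    also have "\<dots> = exp (real (j - 2) * (x / 2))"
      by (simp flip: exp_of_nat_mult)
    also have "real (j - 2) * (x / 2) \<le> real j * (x / 2)"
      using x0 by (intro mult_right_mono) auto
    also have "real j * (x / 2) = 2 * v"
      using j by (simp add: x_def)
    finally have 1: "sqrt x ^ (j - 2) \<le> exp (2 * v)" by simp
    have "sqrt (v / real j) = 1 / 2 * sqrt x"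
      by (simp add: x_def real_sqrt_divide real_sqrt_mult)
    then have "sqrt (v / real j) ^ (j - 2) = (1 / 2) ^ (j - 2) * sqrt x ^ (j - 2)"
      by (metis power_mult_distrib)
    moreover have "sqrt (v / real j) ^ j = sqrt (v / real j) ^ 2 * sqrt (v / real j) ^ (j - 2)"
      using j by (metis le_add_diff_inverse power_add)
    ultimately have "sqrt (v / real j) ^ j = v / real j * ((1 / 2) ^ (j - 2) * sqrt x ^ (j - 2))"
      using assms by simp
    also have "\<dots> \<le> v / 2 * ((1 / 2) ^ (j - 2) * exp (2 * v))"
    proof (rule mult_mono)
      show "v / real j \<le> v / 2"
        using j assms by (intro divide_left_mono) auto
    qed (use 1 assms x0 in \<open>auto intro!: mult_left_mono\<close>)
    finally show ?thesis by (simp add: mult_ac)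
  qed
  then have "(\<Sum>j=2..n. sqrt (v / real j) ^ j) \<le> (\<Sum>j=2..n. v / 2 * exp (2 * v) * (1 / 2) ^ (j - 2))"
    by (intro sum_mono) auto
  also have "\<dots> \<le> v / 2 * exp (2 * v) * 2"
    unfolding sum_distrib_left[symmetric] using assms sum_half_powers_le by (intro mult_left_mono) auto
  finally show ?thesis by simp
qed

context prob_space
begin

text \<open>The growth \<open>(G j^\<kappa>)^j\<close> meets \<open>j! >= (j / e)^j\<close>, which
  leaves the exponent \<open>\<kappa> - 1\<close>. Mean zero removes the term j = 1, so the series
  is 1 plus a quantity of second order in z.\<close>

lemma moment_series_le:
  fixes X :: "'a \<Rightarrow> real"
  assumes "expectation X = 0" "z > 0" "G > 0"
    and "\<And>k. k \<ge> 1 \<Longrightarrow> \<bar>expectation (\<lambda>w. X w ^ k)\<bar> \<le> (G * real k powr \<kappa>) ^ k"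
  shows "(\<Sum>j\<le>n. z ^ j * \<bar>expectation (\<lambda>w. X w ^ j)\<bar> / fact j)
    \<le> 1 + (\<Sum>j=2..n. (exp 1 * G * z * real j powr (\<kappa> - 1)) ^ j)"
proof -
  let ?f = "\<lambda>j. z ^ j * \<bar>expectation (\<lambda>w. X w ^ j)\<bar> / fact j"
  have "(\<Sum>j\<le>n. ?f j) \<le> (\<Sum>j\<in>{0,1} \<union> {2..n}. ?f j)"
    using assms(2) by (intro sum_mono2) auto
  also have "\<dots> = (\<Sum>j\<in>{0,1}. ?f j) + (\<Sum>j=2..n. ?f j)"
    by (rule sum.union_disjoint) auto
  also have "(\<Sum>j\<in>{0,1}. ?f j) = 1"
    using assms(1) by (simp add: prob_space)
  also have "(\<Sum>j=2..n. ?f j) \<le> (\<Sum>j=2..n. (exp 1 * G * z * real j powr (\<kappa> - 1)) ^ j)"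
  proof (rule sum_mono)
    fix j assume j: "j \<in> {2..n}"
    have "real j ^ j \<le> exp 1 ^ j * fact j"
      using power_self_le_exp_fact[of j] by (simp flip: exp_of_nat_mult)
    then have *: "1 / fact j \<le> (exp 1 / real j) ^ j"
      using j by (simp add: field_simps power_divide)
    have "?f j \<le> z ^ j * (G * real j powr \<kappa>) ^ j * (1 / fact j)"
      using assms(4)[of j] assms(2) j by (auto intro!: divide_right_mono mult_left_mono)
    also have "\<dots> \<le> z ^ j * (G * real j powr \<kappa>) ^ j * (exp 1 / real j) ^ j"
      using * assms(2,3) by (intro mult_left_mono) auto
    also have "\<dots> = (exp 1 * G * z * real j powr (\<kappa> - 1)) ^ j"
      using j by (simp add: powr_diff field_simps flip: power_mult_distrib)
    finally show "?f j \<le> (exp 1 * G * z * real j powr (\<kappa> - 1)) ^ j" .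
  qed
  finally show ?thesis by simp
qed

text \<open>\<open>y\<close> is the Cauchy radius up to scaling. It is admissible when each of the
  \<open>card I\<close> factors stays below \<open>exp (c m / card I)\<close>, because their product
  is then only \<open>exp c ^ m\<close>. The two regimes below are two choices of
  \<open>y\<close>.\<close>

lemma indep_sum_even_moment:
  fixes X :: "'i \<Rightarrow> 'a \<Rightarrow> real"
  assumes I: "finite I" "I \<noteq> {}" "indep_vars (\<lambda>_. borel) X I"
    and int: "\<And>i k. i \<in> I \<Longrightarrow> integrable M (\<lambda>w. X i w ^ k)"
    and mean: "\<And>i. i \<in> I \<Longrightarrow> expectation (X i) = 0" and "G > 0" "m \<ge> 1"
    and mom: "\<And>i k. i \<in> I \<Longrightarrow> k \<ge> 1 \<Longrightarrow> \<bar>expectation (\<lambda>w. X i w ^ k)\<bar> \<le> (G * real k powr \<kappa>) ^ k"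
    and y: "y > 0" "(\<Sum>j=2..2*m. (y * real j powr (\<kappa> - 1)) ^ j) \<le> exp (c * real m / real (card I)) - 1"
  shows "expectation (\<lambda>w. (\<Sum>i\<in>I. X i w) ^ (2 * m)) \<le>
    ((2 * real m)\<^sup>2 * (exp 1 * G)\<^sup>2 * exp c / y\<^sup>2) ^ m"
proof -
  define z where "z = y / (exp 1 * G)"
  have z: "z > 0" "exp 1 * G * z = y" using y \<open>G > 0\<close> by (simp_all add: z_def)
  let ?F = "\<lambda>_::'i. exp (c * real m / real (card I))"
  have "(\<Sum>j\<le>2*m. z ^ j * \<bar>expectation (\<lambda>w. X i w ^ j)\<bar> / fact j) \<le> ?F i" if "i \<in> I" for i
    using moment_series_le[OF mean[OF that] z(1) \<open>G > 0\<close> mom[OF that], of "2 * m"] y(2)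
    unfolding z(2) by simp
  from indep_sum_moment[OF I(1,3) int z(1) this]
  have "\<bar>expectation (\<lambda>w. (\<Sum>i\<in>I. X i w) ^ (2 * m))\<bar> \<le> fact (2 * m) / z ^ (2 * m) * prod ?F I"
    by auto
  also have "prod ?F I = exp c ^ m"
    using I(1,2) by (simp add: mult.commute flip: exp_of_nat_mult)
  also have "fact (2 * m) / z ^ (2 * m) * exp c ^ m \<le> real (2 * m) ^ (2 * m) / z ^ (2 * m) * exp c ^ m"
    using fact_le_power_self[of "2 * m"] z(1) by (intro mult_right_mono divide_right_mono) auto
  also have "\<dots> = ((2 * real m)\<^sup>2 * (exp 1 * G)\<^sup>2 * exp c / y\<^sup>2) ^ m"
    using y(1) \<open>G > 0\<close> by (simp add: z_def power_mult power_divide power_mult_distrib)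
  finally show ?thesis by simp
qed

text \<open>For \<open>j <= 2 m\<close> the factor \<open>j^(\<kappa> - 1/2)\<close> is replaced by
  its largest value; here \<open>\<kappa> >= 1/2\<close>, that is \<open>\<alpha> <= 2\<close>,
  enters. The radius \<open>y\<close> cancels this value, and the series with terms
  \<open>sqrt (v / j) ^ j\<close> remains.\<close>

lemma indep_sum_moment_stretched:
  fixes X :: "'i \<Rightarrow> 'a \<Rightarrow> real"
  assumes I: "finite I" "I \<noteq> {}" "indep_vars (\<lambda>_. borel) X I"
    and int: "\<And>i k. i \<in> I \<Longrightarrow> integrable M (\<lambda>w. X i w ^ k)"
    and mean: "\<And>i. i \<in> I \<Longrightarrow> expectation (X i) = 0" and "G > 0" "m \<ge> 1" "\<kappa> \<ge> 1 / 2"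
    and mom: "\<And>i k. i \<in> I \<Longrightarrow> k \<ge> 1 \<Longrightarrow> \<bar>expectation (\<lambda>w. X i w ^ k)\<bar> \<le> (G * real k powr \<kappa>) ^ k"
  shows "expectation (\<lambda>w. (\<Sum>i\<in>I. X i w) ^ (2 * m)) \<le>
    (real (card I) * (2 * exp 5 * G\<^sup>2 * (2 * real m) powr (2 * \<kappa>))) ^ m"
proof -
  define v where "v = real m / real (card I)"
  have cI: "card I > 0" using I by (simp add: card_gt_0_iff)
  have v: "v > 0" using cI \<open>m \<ge> 1\<close> by (simp add: v_def)
  define y where "y = sqrt v * (2 * real m) powr (1 / 2 - \<kappa>)"
  have y: "y > 0" using v \<open>m \<ge> 1\<close> by (simp add: y_def)
  have "y * real j powr (\<kappa> - 1) \<le> sqrt (v / real j)" if j: "j \<in> {2..2*m}" for j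
  proof -
    have "real j powr (\<kappa> - 1) = real j powr (\<kappa> - 1 / 2) * real j powr (- 1 / 2)"
      by (simp flip: powr_add)
    also have "\<dots> \<le> (2 * real m) powr (\<kappa> - 1 / 2) * real j powr (- 1 / 2)"
      using j \<open>\<kappa> \<ge> 1 / 2\<close> by (intro mult_right_mono powr_mono2) auto
    also have "real j powr (- 1 / 2) = 1 / sqrt (real j)"
      using j by (simp add: powr_minus_divide powr_half_sqrt)
    finally have "y * real j powr (\<kappa> - 1) \<le> y * ((2 * real m) powr (\<kappa> - 1 / 2) * (1 / sqrt (real j)))"
      using y by (intro mult_left_mono) auto
    also have "\<dots> = sqrt v * ((2 * real m) powr (1 / 2 - \<kappa>) * (2 * real m) powr (\<kappa> - 1 / 2)) / sqrt (real j)"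
      by (simp add: y_def)
    also have "(2 * real m) powr (1 / 2 - \<kappa>) * (2 * real m) powr (\<kappa> - 1 / 2) = 1"
      using \<open>m \<ge> 1\<close> by (simp flip: powr_add)
    finally show ?thesis by (simp add: real_sqrt_divide)
  qed
  then have "(\<Sum>j=2..2*m. (y * real j powr (\<kappa> - 1)) ^ j) \<le> (\<Sum>j=2..2*m. sqrt (v / real j) ^ j)"
    using y by (intro sum_mono power_mono) auto
  also have "\<dots> \<le> v * exp (2 * v)"
    using stretched_series_bound v by simp
  \<comment> \<open>This fixes \<open>c = 3\<close>; together with \<open>(exp 1)^2\<close> from the
    radius it becomes the \<open>exp 5\<close> of the statement.\<close>
  also have "\<dots> \<le> exp (3 * v) - 1"
  proof -
    have "1 + v * exp (2 * v) \<le> (1 + v) * exp (2 * v)"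
      using v by (simp add: algebra_simps)
    also have "\<dots> \<le> exp v * exp (2 * v)"
      by (intro mult_right_mono) auto
    finally show ?thesis by (simp flip: exp_add)
  qed
  finally have "(\<Sum>j=2..2*m. (y * real j powr (\<kappa> - 1)) ^ j) \<le> exp (3 * real m / real (card I)) - 1"
    by (simp add: v_def)
  from indep_sum_even_moment[OF I int mean \<open>G > 0\<close> \<open>m \<ge> 1\<close> mom y this]
  have "expectation (\<lambda>w. (\<Sum>i\<in>I. X i w) ^ (2 * m)) \<le> ((2 * real m)\<^sup>2 * (exp 1 * G)\<^sup>2 * exp 3 / y\<^sup>2) ^ m"
    by auto
  also have "(2 * real m)\<^sup>2 * (exp 1 * G)\<^sup>2 * exp 3 / y\<^sup>2 = real (card I) * (2 * exp 5 * G\<^sup>2 * (2 * real m) powr (2 * \<kappa>))"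
  proof -
    have "y\<^sup>2 = v * ((2 * real m) powr (1 / 2 - \<kappa>))\<^sup>2"
      using v by (simp add: y_def power_mult_distrib)
    also have "((2 * real m) powr (1 / 2 - \<kappa>))\<^sup>2 = (2 * real m) powr (1 - 2 * \<kappa>)"
      using \<open>m \<ge> 1\<close> by (simp add: power2_eq_square flip: powr_add)
    also have "\<dots> = 2 * real m / (2 * real m) powr (2 * \<kappa>)"
      using \<open>m \<ge> 1\<close> by (simp add: powr_diff)
    finally have y2: "y\<^sup>2 = 2 * (real m)\<^sup>2 / (real (card I) * (2 * real m) powr (2 * \<kappa>))"
      by (simp add: v_def power2_eq_square)
    have "(exp 1)\<^sup>2 * exp 3 = (exp 5 :: real)"
      by (simp add: power2_eq_square flip: exp_add)
    then have "(2 * real m)\<^sup>2 * (exp 1 * G)\<^sup>2 * exp 3 = (2 * real m)\<^sup>2 * G\<^sup>2 * exp 5"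
      by (simp add: power_mult_distrib mult_ac)
    then show ?thesis
      unfolding y2 using \<open>m \<ge> 1\<close> cI by (auto simp add: power2_eq_square)
  qed
  finally show ?thesis .
qed

text \<open>With \<open>y^2 = m / card I\<close> the quadratic term alone gives the Gaussian rate.
  The hypothesis \<open>large\<close> is tailored to the rest: each of the fewer than
  \<open>2 m\<close> terms with \<open>j >= 3\<close> is at most
  \<open>y^3 (2 m)^(3 \<kappa>)\<close>, and \<open>y (2 m)^(3 \<kappa> + 1) <= 1\<close>, so
  together they add at most another \<open>y^2\<close>.\<close>

lemma indep_sum_moment_gaussian:
  fixes X :: "'i \<Rightarrow> 'a \<Rightarrow> real"
  assumes I: "finite I" "I \<noteq> {}" "indep_vars (\<lambda>_. borel) X I"
    and int: "\<And>i k. i \<in> I \<Longrightarrow> integrable M (\<lambda>w. X i w ^ k)"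
    and mean: "\<And>i. i \<in> I \<Longrightarrow> expectation (X i) = 0" and "G > 0" "m \<ge> 1" "\<kappa> \<ge> 0"
    and mom: "\<And>i k. i \<in> I \<Longrightarrow> k \<ge> 1 \<Longrightarrow> \<bar>expectation (\<lambda>w. X i w ^ k)\<bar> \<le> (G * real k powr \<kappa>) ^ k"
    and large: "(2 * real m) powr (6 * \<kappa> + 3) \<le> real (card I)"
  shows "expectation (\<lambda>w. (\<Sum>i\<in>I. X i w) ^ (2 * m)) \<le>
    (real (card I) * (4 * exp (3 + 4 powr \<kappa>) * G\<^sup>2 * real m)) ^ m"
proof -
  define y where "y = sqrt (real m / real (card I))"
  define b where "b = 2 * real m"
  have b: "b \<ge> 2" using \<open>m \<ge> 1\<close> by (simp add: b_def)
  have cI: "card I > 0" using I by (simp add: card_gt_0_iff)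
  have y: "y > 0" and y2: "y\<^sup>2 = real m / real (card I)" using cI \<open>m \<ge> 1\<close> by (simp_all add: y_def)
  have "(y * b powr (3 * \<kappa> + 1))\<^sup>2 \<le> 1"
  proof -
    have "(b powr (3 * \<kappa> + 1))\<^sup>2 = b powr (6 * \<kappa> + 2)"
      using b by (simp add: power2_eq_square flip: powr_add)
    moreover have "real m * b powr (6 * \<kappa> + 2) \<le> b powr 1 * b powr (6 * \<kappa> + 2)"
      using b by (intro mult_right_mono) (auto simp: b_def)
    moreover have "b powr 1 * b powr (6 * \<kappa> + 2) = b powr (6 * \<kappa> + 3)"
      by (simp only: flip: powr_add) (simp add: add_ac)
    ultimately show ?thesis
      using large cI by (simp add: power_mult_distrib y2 b_def field_simps)
  qed
  then have yb: "y * b powr (3 * \<kappa> + 1) \<le> 1"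
    by (rule power2_le_imp_le[of _ 1, simplified])
  have t3: "(y * real j powr (\<kappa> - 1)) ^ j \<le> y\<^sup>2 * (y * b powr (3 * \<kappa>))" if j: "j \<in> {3..2*m}" for j
  proof -
    have "real j powr (\<kappa> - 1) \<le> real j powr \<kappa>"
      using j by (intro powr_mono) auto
    also have "\<dots> \<le> b powr \<kappa>"
      using j \<open>\<kappa> \<ge> 0\<close> by (intro powr_mono2) (auto simp: b_def)
    finally have "(y * real j powr (\<kappa> - 1)) ^ j \<le> (y * b powr \<kappa>) ^ j"
      using y by (intro power_mono mult_left_mono) auto
    also have "\<dots> \<le> (y * b powr \<kappa>) ^ 3"
    proof (rule power_decreasing)
      have "y * b powr \<kappa> \<le> y * b powr (3 * \<kappa> + 1)"
        using y b \<open>\<kappa> \<ge> 0\<close> by (intro mult_left_mono powr_mono) auto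
      then show "y * b powr \<kappa> \<le> 1" using yb by simp
    qed (use j y in auto)
    also have "\<dots> = y\<^sup>2 * (y * b powr (3 * \<kappa>))"
      using b by (simp add: power_mult_distrib power2_eq_square power3_eq_cube flip: powr_add)
    finally show ?thesis .
  qed
  have "(\<Sum>j=2..2*m. (y * real j powr (\<kappa> - 1)) ^ j) =
      (y * 2 powr (\<kappa> - 1))\<^sup>2 + (\<Sum>j=3..2*m. (y * real j powr (\<kappa> - 1)) ^ j)"
    using \<open>m \<ge> 1\<close> by (subst sum.atLeast_Suc_atMost) auto
  also have "(\<Sum>j=3..2*m. (y * real j powr (\<kappa> - 1)) ^ j) \<le> real (card {3..2*m}) * (y\<^sup>2 * (y * b powr (3 * \<kappa>)))"
    using t3 by (rule sum_bounded_above)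
  also have "\<dots> \<le> b * (y\<^sup>2 * (y * b powr (3 * \<kappa>)))"
    using y by (intro mult_right_mono) (auto simp: b_def)
  also have "\<dots> = y\<^sup>2 * (y * b powr (3 * \<kappa> + 1))"
    using b by (simp add: powr_add)
  also have "\<dots> \<le> y\<^sup>2 * 1"
    using yb by (intro mult_left_mono) auto
  also have "(y * 2 powr (\<kappa> - 1))\<^sup>2 = y\<^sup>2 * (4 powr \<kappa> / 4)"
  proof -
    have "(2 powr (\<kappa> - 1))\<^sup>2 = (2 * 2) powr \<kappa> / (4 :: real)"
      by (subst powr_mult) (simp_all add: powr_diff power2_eq_square)
    then show ?thesis by (simp add: power_mult_distrib)
  qed
  also have "y\<^sup>2 * (4 powr \<kappa> / 4) \<le> y\<^sup>2 * 4 powr \<kappa>"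
    by (intro mult_left_mono) auto
  finally have "(\<Sum>j=2..2*m. (y * real j powr (\<kappa> - 1)) ^ j) \<le> (1 + 4 powr \<kappa>) * real m / real (card I)"
    unfolding y2 by (simp add: algebra_simps add_divide_distrib)
  also have "\<dots> \<le> exp ((1 + 4 powr \<kappa>) * real m / real (card I)) - 1"
    using exp_ge_add_one_self[of "(1 + 4 powr \<kappa>) * real m / real (card I)"] by linarith
  finally have "(\<Sum>j=2..2*m. (y * real j powr (\<kappa> - 1)) ^ j) \<le> exp ((1 + 4 powr \<kappa>) * real m / real (card I)) - 1" .
  from indep_sum_even_moment[OF I int mean \<open>G > 0\<close> \<open>m \<ge> 1\<close> mom y this]
  have "expectation (\<lambda>w. (\<Sum>i\<in>I. X i w) ^ (2 * m)) \<le>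
      ((2 * real m)\<^sup>2 * (exp 1 * G)\<^sup>2 * exp (1 + 4 powr \<kappa>) / y\<^sup>2) ^ m"
    by auto
  also have "(2 * real m)\<^sup>2 * (exp 1 * G)\<^sup>2 * exp (1 + 4 powr \<kappa>) / y\<^sup>2 =
      real (card I) * (4 * exp (3 + 4 powr \<kappa>) * G\<^sup>2 * real m)"
  proof -
    have "(exp 1)\<^sup>2 * exp (1 + 4 powr \<kappa>) = (exp (3 + 4 powr \<kappa>) :: real)"
      by (simp add: power2_eq_square flip: exp_add)
    then have "(2 * real m)\<^sup>2 * (exp 1 * G)\<^sup>2 * exp (1 + 4 powr \<kappa>) = (2 * real m)\<^sup>2 * G\<^sup>2 * exp (3 + 4 powr \<kappa>)"
      by (simp add: power_mult_distrib mult_ac)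
    then show ?thesis
      unfolding y2 using \<open>m \<ge> 1\<close> cI by (auto simp add: power2_eq_square)
  qed
  finally show ?thesis .
qed

lemma indep_sum_second_moment:
  fixes X :: "'i \<Rightarrow> 'a \<Rightarrow> real"
  assumes "finite I" "indep_vars (\<lambda>_. borel) X I"
    and int: "\<And>i k. i \<in> I \<Longrightarrow> integrable M (\<lambda>w. X i w ^ k)"
    and mean: "\<And>i. i \<in> I \<Longrightarrow> expectation (X i) = 0"
  shows "expectation (\<lambda>w. (\<Sum>i\<in>I. X i w)\<^sup>2) = (\<Sum>i\<in>I. expectation (\<lambda>w. (X i w)\<^sup>2))"
  using assms
proof (induction I)
  case (insert i I)
  define S where "S w = (\<Sum>i\<in>I. X i w)" for w
  have ind: "indep_var borel (X i) borel S"
    using indep_vars_sum[OF insert.hyps insert.prems(1)] unfolding S_def .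
  have indI: "indep_vars (\<lambda>_. borel) X I"
    using insert.prems(1) by (rule indep_vars_subset) auto
  have iX: "\<And>k. integrable M (\<lambda>w. X i w ^ k)" "expectation (X i) = 0"
    using insert.prems by simp_all
  \<comment> \<open>The moment estimate at \<open>m = 0\<close>, \<open>z = 1\<close>,
    \<open>F = 1\<close>, where its hypothesis on the series reads \<open>1 <= 1\<close>: only the
    integrability of all powers is wanted.\<close>
  have iS: "\<And>k. integrable M (\<lambda>w. S w ^ k)"
    unfolding S_def using indep_sum_moment[OF insert.hyps(1) indI, of 1 0 "\<lambda>_. 1"] insert.prems(2)
    by (simp add: prob_space)
  note * = indep_var_power_integral[OF ind iX(1) iS, of 1 1, simplified]
  have "expectation (\<lambda>w. (\<Sum>i\<in>insert i I. X i w)\<^sup>2)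
      = expectation (\<lambda>w. (X i w)\<^sup>2 + (S w)\<^sup>2 + 2 * (X i w * S w))"
    using insert.hyps by (intro Bochner_Integration.integral_cong) (auto simp: S_def power2_eq_square algebra_simps)
  also have "\<dots> = expectation (\<lambda>w. (X i w)\<^sup>2) + expectation (\<lambda>w. (S w)\<^sup>2) + 2 * expectation (\<lambda>w. X i w * S w)"
    using iX(1)[of 2] iS[of 2] *(1)
    by (subst Bochner_Integration.integral_add; (intro Bochner_Integration.integrable_add integrable_mult_right)?)+ auto
  also have "\<dots> = expectation (\<lambda>w. (X i w)\<^sup>2) + expectation (\<lambda>w. (S w)\<^sup>2)"
    using *(2) iX(2) by simp
  also have "expectation (\<lambda>w. (S w)\<^sup>2) = (\<Sum>i\<in>I. expectation (\<lambda>w. (X i w)\<^sup>2))"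
    unfolding S_def using insert indI by auto
  finally show ?case using insert.hyps by simp
qed simp

lemma markov_even_power:
  fixes f :: "'a \<Rightarrow> real"
  assumes "integrable M (\<lambda>w. f w ^ (2 * m))" "f \<in> borel_measurable M" "x > 0"
  shows "prob {w \<in> space M. x \<le> \<bar>f w\<bar>} \<le> expectation (\<lambda>w. f w ^ (2 * m)) / x ^ (2 * m)"
proof -
  have "prob {w \<in> space M. x \<le> \<bar>f w\<bar>} \<le> prob {w \<in> space M. x ^ (2 * m) \<le> f w ^ (2 * m)}"
  proof (rule finite_measure_mono)
    show "{w \<in> space M. x \<le> \<bar>f w\<bar>} \<subseteq> {w \<in> space M. x ^ (2 * m) \<le> f w ^ (2 * m)}"
      using assms(3) power_mono[of x "\<bar>f _\<bar>" "2 * m"] by (auto simp: power_even_abs)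
  qed (use assms(2) in measurable)
  also have "\<dots> \<le> expectation (\<lambda>w. f w ^ (2 * m)) / x ^ (2 * m)"
    using assms by (intro integral_Markov_inequality_measure[where A = "{}"]) auto
  finally show ?thesis .
qed

end

lemma abs_square_minus_one_power_le:
  fixes y :: real
  shows "\<bar>y\<^sup>2 - 1\<bar> ^ k \<le> y ^ (2 * k) + 1"
proof (cases "y\<^sup>2 \<le> 1")
  case True
  then have "\<bar>y\<^sup>2 - 1\<bar> ^ k \<le> 1" by (intro power_le_one) auto
  then show ?thesis by (simp add: power_mult add_increasing)
next
  case False
  then have "\<bar>y\<^sup>2 - 1\<bar> ^ k \<le> (y\<^sup>2) ^ k" by (intro power_mono) auto
  then show ?thesis by (simp add: power_mult)
qed

section \<open>Arrays of independent variables with stretched exponential tails\<close>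

text \<open>The constant in the bound \<open>(stretched_const * m^(2 \<kappa>))^m\<close> for the
  moment of order \<open>2 m\<close> of a normalised row sum. \<open>4 powr \<kappa>\<close> comes
  from splitting \<open>(2 m) powr (2 \<kappa>)\<close>.\<close>

definition stretched_const :: "real \<Rightarrow> real \<Rightarrow> real" where
  "stretched_const G \<kappa> = 2 * exp 5 * G\<^sup>2 * 4 powr \<kappa>"

definition gauss_const :: "real \<Rightarrow> real \<Rightarrow> real" where
  "gauss_const G \<kappa> = 4 * exp (3 + 4 powr \<kappa>) * G\<^sup>2"

text \<open>The case m = 2 of the stretched bound. It controls fourth moments of row sums, hence the
  second moments of their squares.\<close>

definition fourth_const :: "real \<Rightarrow> real \<Rightarrow> real" where
  "fourth_const G \<kappa> = (stretched_const G \<kappa> * 4 powr \<kappa>)\<^sup>2"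

text \<open>\<open>+ 1\<close> pays for the centring in \<open>N^2 - 1\<close>, and
  \<open>exp 1\<close> for replacing \<open>k ^ k\<close> by \<open>k!\<close>.\<close>

definition deviation_const :: "real \<Rightarrow> real \<Rightarrow> real" where
  "deviation_const G \<kappa> = exp 1 * (gauss_const G \<kappa> + 1)"

lemma const_pos:
  assumes "G > 0"
  shows "stretched_const G \<kappa> > 0" "gauss_const G \<kappa> > 0" "fourth_const G \<kappa> > 0" "deviation_const G \<kappa> > 0"
proof -
  show 1: "stretched_const G \<kappa> > 0" and 2: "gauss_const G \<kappa> > 0"
    using assms by (simp_all add: stretched_const_def gauss_const_def)
  show "fourth_const G \<kappa> > 0" "deviation_const G \<kappa> > 0"
    using 1 2 by (simp_all add: fourth_const_def deviation_const_def)
qed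

text \<open>An entry stands for the difference of two independent noise entries of unit variance,
  hence the second moment 2. \<open>J\<close> holds the coordinates, \<open>C\<close> the pairs of
  mirrored columns, and \<open>\<kappa>\<close> is \<open>1 / \<alpha>\<close>.\<close>

locale noise_array = prob_space M for M :: "'a measure" +
  fixes D :: "nat \<times> nat \<Rightarrow> 'a \<Rightarrow> real" and J C :: "nat set" and G \<kappa> :: real
  assumes finite_J: "finite J" and finite_C: "finite C"
    and indep: "indep_vars (\<lambda>_. borel) D (J \<times> C)"
    and integrable_D: "i \<in> J \<times> C \<Longrightarrow> integrable M (\<lambda>w. D i w ^ k)"
    and mean_D: "i \<in> J \<times> C \<Longrightarrow> expectation (D i) = 0"
    and square_D: "i \<in> J \<times> C \<Longrightarrow> expectation (\<lambda>w. (D i w)\<^sup>2) = 2"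
    and moment_D: "i \<in> J \<times> C \<Longrightarrow> k \<ge> 1 \<Longrightarrow>
        \<bar>expectation (\<lambda>w. D i w ^ k)\<bar> \<le> (G * real k powr \<kappa>) ^ k"
    and G: "G > 0" and \<kappa>: "\<kappa> \<ge> 1 / 2"
begin

definition N :: "nat set \<Rightarrow> nat \<Rightarrow> 'a \<Rightarrow> real" where
  "N V j w = (\<Sum>c\<in>V. D (j, c) w) / sqrt (2 * real (card V))"

text \<open>Under the null this is the summand of \<open>A_{t,a}\<close>, with \<open>V1\<close> and
  \<open>V2\<close> the columns of \<open>Y_{t,1}\<close> and \<open>Y_{t,2}\<close>; at t = 1 the
  two sets coincide.\<close>

definition excess :: "nat set \<Rightarrow> nat set \<Rightarrow> real \<Rightarrow> nat \<Rightarrow> 'a \<Rightarrow> real" where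
  "excess V1 V2 a j w = ((N V1 j w)\<^sup>2 - 1) * of_bool (a \<le> \<bar>N V2 j w\<bar>)"

lemmas consts_pos = const_pos[OF G, of \<kappa>]

lemma D_measurable [measurable]: "i \<in> J \<times> C \<Longrightarrow> random_variable borel (D i)"
  using indep unfolding indep_vars_def by auto

lemma N_measurable [measurable]:
  assumes "V \<subseteq> C" "j \<in> J"
  shows "N V j \<in> borel_measurable M"
  unfolding N_def using assms by (intro borel_measurable_divide borel_measurable_sum) auto

lemma excess_measurable [measurable]:
  assumes "V1 \<subseteq> C" "V2 \<subseteq> C" "j \<in> J"
  shows "excess V1 V2 a j \<in> borel_measurable M"
proof -
  note [measurable] = N_measurable[OF assms(1,3)] N_measurable[OF assms(2,3)]
  show ?thesis unfolding excess_def of_bool_def by measurable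
qed

context
  fixes V j assumes V: "V \<subseteq> C" "V \<noteq> {}" and j: "j \<in> J"
begin

lemma card_V: "card V > 0"
  using V finite_C by (auto simp: card_gt_0_iff dest: finite_subset)

lemma row_indep: "finite ({j} \<times> V)" "{j} \<times> V \<noteq> {}" "indep_vars (\<lambda>_. borel) D ({j} \<times> V)"
    "{j} \<times> V \<subseteq> J \<times> C"
proof -
  show "{j} \<times> V \<subseteq> J \<times> C" using V j by auto
  then show "indep_vars (\<lambda>_. borel) D ({j} \<times> V)" by (rule indep_vars_subset[OF indep])
qed (use V finite_C in \<open>auto dest: finite_subset\<close>)

lemma card_row: "card ({j} \<times> V) = card V"
  by (rule card_cartesian_product_singleton)

lemma N_eq: "N V j w = (\<Sum>i\<in>{j} \<times> V. D i w) / sqrt (2 * real (card V))"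
  unfolding N_def by (simp add: sum.cartesian_product' sum.insert)

lemma N_power_eq: "N V j w ^ (2 * m) = (\<Sum>i\<in>{j} \<times> V. D i w) ^ (2 * m) / (2 * real (card V)) ^ m"
  unfolding N_eq by (simp add: power_divide power_mult)

lemma integrable_N: "integrable M (\<lambda>w. N V j w ^ k)"
proof -
  have "integrable M (\<lambda>w. (\<Sum>i\<in>{j} \<times> V. D i w) ^ k)"
    using indep_sum_moment[OF row_indep(1,3), of 1 0 "\<lambda>_. 1"] integrable_D subsetD[OF row_indep(4)]
    by (simp add: prob_space)
  then show ?thesis
    unfolding N_eq power_divide by simp
qed

lemma expectation_N_square: "expectation (\<lambda>w. (N V j w)\<^sup>2) = 1"
proof -
  have "expectation (\<lambda>w. (\<Sum>i\<in>{j} \<times> V. D i w)\<^sup>2) = (\<Sum>i\<in>{j} \<times> V. expectation (\<lambda>w. (D i w)\<^sup>2))"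
    using row_indep integrable_D mean_D by (intro indep_sum_second_moment) blast+
  also have "\<dots> = (\<Sum>i\<in>{j} \<times> V. 2)"
    using row_indep(4) square_D by (intro sum.cong) auto
  finally show ?thesis
    using card_V N_power_eq[of _ 1] by (simp add: card_row)
qed

lemma N_moment_stretched:
  assumes "m \<ge> 1"
  shows "expectation (\<lambda>w. N V j w ^ (2 * m)) \<le> (stretched_const G \<kappa> * real m powr (2 * \<kappa>)) ^ m"
proof -
  have "expectation (\<lambda>w. (\<Sum>i\<in>{j} \<times> V. D i w) ^ (2 * m)) \<le>
      (real (card ({j} \<times> V)) * (2 * exp 5 * G\<^sup>2 * (2 * real m) powr (2 * \<kappa>))) ^ m"
    using row_indep integrable_D mean_D moment_D G \<kappa> assms
    by (intro indep_sum_moment_stretched) blast+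
  also have "\<dots> = (real (card V) * (stretched_const G \<kappa> * real m powr (2 * \<kappa>))) ^ m"
  proof -
    have "(2 * real m) powr (2 * \<kappa>) = (2 powr 2) powr \<kappa> * real m powr (2 * \<kappa>)"
      unfolding powr_powr by (simp add: powr_mult)
    then show ?thesis by (simp add: stretched_const_def card_row mult_ac)
  qed
  also have "\<dots> \<le> (2 * real (card V) * (stretched_const G \<kappa> * real m powr (2 * \<kappa>))) ^ m"
    using consts_pos by (intro power_mono mult_right_mono) auto
  finally show ?thesis
    unfolding N_power_eq using card_V by (simp add: power_mult_distrib field_simps)
qed

lemma N_moment_gaussian:
  assumes "m \<ge> 1" "(2 * real m) powr (6 * \<kappa> + 3) \<le> real (card V)"
  shows "expectation (\<lambda>w. N V j w ^ (2 * m)) \<le> (gauss_const G \<kappa> * real m) ^ m"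
proof -
  have "expectation (\<lambda>w. (\<Sum>i\<in>{j} \<times> V. D i w) ^ (2 * m)) \<le>
      (real (card ({j} \<times> V)) * (4 * exp (3 + 4 powr \<kappa>) * G\<^sup>2 * real m)) ^ m"
  proof (rule indep_sum_moment_gaussian[where \<kappa> = \<kappa>])
    show "(2 * real m) powr (6 * \<kappa> + 3) \<le> real (card ({j} \<times> V))" "\<kappa> \<ge> 0"
      using assms \<kappa> by (auto simp: card_row)
  qed (use row_indep integrable_D mean_D moment_D G assms in blast)+
  also have "\<dots> \<le> (2 * real (card V) * (gauss_const G \<kappa> * real m)) ^ m"
    using consts_pos by (intro power_mono) (auto simp: gauss_const_def card_row mult_ac)
  finally show ?thesis
    unfolding N_power_eq using card_V by (simp add: power_mult_distrib field_simps)
qed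

lemma N_tail:
  assumes "m \<ge> 1" "a > 0"
  shows "prob {w \<in> space M. a \<le> \<bar>N V j w\<bar>} \<le> (stretched_const G \<kappa> * real m powr (2 * \<kappa>) / a\<^sup>2) ^ m"
proof -
  have "prob {w \<in> space M. a \<le> \<bar>N V j w\<bar>} \<le> expectation (\<lambda>w. N V j w ^ (2 * m)) / a ^ (2 * m)"
    using V j assms by (intro markov_even_power integrable_N) measurable
  also have "\<dots> \<le> (stretched_const G \<kappa> * real m powr (2 * \<kappa>)) ^ m / a ^ (2 * m)"
    using N_moment_stretched[OF assms(1)] assms(2) by (intro divide_right_mono) auto
  also have "\<dots> = (stretched_const G \<kappa> * real m powr (2 * \<kappa>) / a\<^sup>2) ^ m"
    by (simp add: power_divide power_mult)
  finally show ?thesis .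
qed

text \<open>Markov's inequality at the order \<open>2 m\<close> with m the rounded \<open>L\<close>:
  the condition on \<open>c\<close> makes each of the m factors at most \<open>exp (-2)\<close>.
  Rounding gives \<open>m <= 2 L\<close>, since \<open>L >= 1\<close>, and costs the factor
  \<open>4 powr \<kappa>\<close> in that condition.\<close>

lemma N_tail_exp:
  assumes "L \<ge> 1" "a \<ge> c * L powr \<kappa>" "c > 0" "c\<^sup>2 \<ge> exp 2 * 4 powr \<kappa> * stretched_const G \<kappa>"
  shows "prob {w \<in> space M. a \<le> \<bar>N V j w\<bar>} \<le> exp (- 2 * L)"
proof -
  define m where "m = nat \<lceil>L\<rceil>"
  have m: "L \<le> real m" "real m \<le> 2 * L" "m \<ge> 1"
    using assms(1) by (auto simp: m_def) linarith+
  have a: "a > 0"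
    using assms by (smt (verit) mult_pos_pos powr_gt_zero)
  have "real m powr (2 * \<kappa>) \<le> (2 * L) powr (2 * \<kappa>)"
    using m \<kappa> by (intro powr_mono2) auto
  also have "\<dots> = 4 powr \<kappa> * (L powr \<kappa>)\<^sup>2"
  proof -
    have "(2 * L) powr (2 * \<kappa>) = (2 powr 2) powr \<kappa> * L powr (2 * \<kappa>)"
      unfolding powr_powr using assms(1) by (simp add: powr_mult)
    then show ?thesis
      by (simp add: power2_eq_square flip: powr_add)
  qed
  finally have "stretched_const G \<kappa> * real m powr (2 * \<kappa>) \<le> stretched_const G \<kappa> * (4 powr \<kappa> * (L powr \<kappa>)\<^sup>2)"
    using consts_pos by (intro mult_left_mono) auto
  also have "exp 2 * \<dots> \<le> c\<^sup>2 * (L powr \<kappa>)\<^sup>2"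
    using mult_right_mono[OF assms(4), of "(L powr \<kappa>)\<^sup>2"] by (simp add: mult_ac)
  also have "\<dots> \<le> a\<^sup>2"
    using assms by (simp flip: power_mult_distrib) (intro power_mono, auto)
  finally have "exp 2 * (stretched_const G \<kappa> * real m powr (2 * \<kappa>)) \<le> a\<^sup>2" by simp
  then have "stretched_const G \<kappa> * real m powr (2 * \<kappa>) / a\<^sup>2 \<le> exp (- 2)"
    using a by (simp add: exp_minus field_simps)
  then have "(stretched_const G \<kappa> * real m powr (2 * \<kappa>) / a\<^sup>2) ^ m \<le> exp (- 2) ^ m"
    using consts_pos by (intro power_mono) auto
  also have "\<dots> = exp (- 2 * real m)"
    by (simp add: mult.commute flip: exp_of_nat_mult)
  also have "\<dots> \<le> exp (- 2 * L)"
    using m by simp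
  finally show ?thesis
    using N_tail[OF m(3) a] by linarith
qed

lemma expectation_abs_deviation:
  shows "integrable M (\<lambda>w. \<bar>(N V j w)\<^sup>2 - 1\<bar> ^ k)"
    and "expectation (\<lambda>w. \<bar>(N V j w)\<^sup>2 - 1\<bar> ^ k) \<le> expectation (\<lambda>w. N V j w ^ (2 * k)) + 1"
proof -
  note [measurable] = N_measurable[OF V(1) j]
  have int: "integrable M (\<lambda>w. N V j w ^ (2 * k) + 1)"
    using integrable_N by simp
  show *: "integrable M (\<lambda>w. \<bar>(N V j w)\<^sup>2 - 1\<bar> ^ k)"
    by (rule Bochner_Integration.integrable_bound[OF int])
      (use abs_square_minus_one_power_le[of "N V j _" k] in \<open>auto simp: power_abs intro: order_trans[OF _ abs_ge_self]\<close>)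
  have "expectation (\<lambda>w. \<bar>(N V j w)\<^sup>2 - 1\<bar> ^ k) \<le> expectation (\<lambda>w. N V j w ^ (2 * k) + 1)"
    by (intro integral_mono * int abs_square_minus_one_power_le)
  also have "\<dots> = expectation (\<lambda>w. N V j w ^ (2 * k)) + 1"
    using integrable_N[of "2 * k"] by (subst Bochner_Integration.integral_add) (auto simp: prob_space)
  finally show "expectation (\<lambda>w. \<bar>(N V j w)\<^sup>2 - 1\<bar> ^ k) \<le> expectation (\<lambda>w. N V j w ^ (2 * k)) + 1" .
qed

end

lemma N_fourth_moment:
  assumes "V \<subseteq> C" "V \<noteq> {}" "j \<in> J"
  shows "expectation (\<lambda>w. N V j w ^ 4) \<le> fourth_const G \<kappa>"
proof -
  have "2 powr (2 * \<kappa>) = (2 powr 2) powr \<kappa>"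
    by (simp only: powr_powr)
  then show ?thesis
    using N_moment_stretched[OF assms, of 2] by (simp add: fourth_const_def)
qed

lemma integrable_excess_power:
  assumes "V1 \<subseteq> C" "V1 \<noteq> {}" "V2 \<subseteq> C" "j \<in> J"
  shows "integrable M (\<lambda>w. excess V1 V2 a j w ^ k)" "integrable M (\<lambda>w. \<bar>excess V1 V2 a j w\<bar> ^ k)"
proof -
  note [measurable] = excess_measurable[OF assms(1,3,4)]
  have *: "\<bar>excess V1 V2 a j w\<bar> ^ k \<le> \<bar>(N V1 j w)\<^sup>2 - 1\<bar> ^ k" for w
    by (intro power_mono) (auto simp: excess_def of_bool_def)
  show "integrable M (\<lambda>w. excess V1 V2 a j w ^ k)" "integrable M (\<lambda>w. \<bar>excess V1 V2 a j w\<bar> ^ k)"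
    by (rule Bochner_Integration.integrable_bound[OF expectation_abs_deviation(1)[OF assms(1,2,4)]];
        use * in \<open>auto simp: power_abs\<close>)+
qed

text \<open>
  Weighted AM-GM instead of independence, so that the bound also covers the case \<open>V1 = V2\<close>.
\<close>

lemma expectation_abs_excess:
  assumes V: "V1 \<subseteq> C" "V1 \<noteq> {}" "V2 \<subseteq> C" "j \<in> J"
    and "x > 0" "prob {w \<in> space M. a \<le> \<bar>N V2 j w\<bar>} \<le> x\<^sup>2"
  shows "expectation (\<lambda>w. \<bar>excess V1 V2 a j w\<bar>) \<le> (fourth_const G \<kappa> + 2) / 2 * x"
proof -
  note [measurable] = N_measurable[OF V(3,4)]
  let ?B = "{w \<in> space M. a \<le> \<bar>N V2 j w\<bar>}"
  \<comment> \<open>The weight \<open>x\<close> balances the terms: a bounded second moment is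
    multiplied by x, and a probability of at most \<open>x^2\<close> is divided by x.\<close>
  let ?g = "\<lambda>w. x / 2 * \<bar>(N V1 j w)\<^sup>2 - 1\<bar> ^ 2 + 1 / (2 * x) * indicator ?B w"
  have "?B \<in> events"
    by measurable
  then have "integrable M (indicator ?B :: 'a \<Rightarrow> real)"
    by (simp add: emeasure_eq_measure)
  then have int: "integrable M (\<lambda>w. x / 2 * \<bar>(N V1 j w)\<^sup>2 - 1\<bar> ^ 2)"
    "integrable M (\<lambda>w. 1 / (2 * x) * indicator ?B w)"
    using expectation_abs_deviation(1)[OF V(1,2,4), of 2] by (intro integrable_mult_right, simp)+
  have "expectation (\<lambda>w. \<bar>excess V1 V2 a j w\<bar>) \<le> expectation ?g"
  proof (rule integral_mono)
    show "integrable M ?g" using int by (rule Bochner_Integration.integrable_add)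
    fix w assume w: "w \<in> space M"
    define u where "u = \<bar>(N V1 j w)\<^sup>2 - 1\<bar>"
    have "0 \<le> (x * u - 1)\<^sup>2" by simp
    then have "2 * x * u \<le> (x * u)\<^sup>2 + 1" by (simp add: power2_eq_square algebra_simps)
    then have "u \<le> x / 2 * u ^ 2 + 1 / (2 * x)"
      using \<open>x > 0\<close> by (simp add: field_simps power2_eq_square)
    moreover have "0 \<le> x / 2 * u ^ 2" using \<open>x > 0\<close> by simp
    ultimately show "\<bar>excess V1 V2 a j w\<bar> \<le> ?g w"
      using w by (auto simp: excess_def u_def[symmetric] abs_mult)
  qed (use integrable_excess_power(2)[OF V, of a 1] in simp)
  also have "\<dots> = x / 2 * expectation (\<lambda>w. \<bar>(N V1 j w)\<^sup>2 - 1\<bar> ^ 2) + 1 / (2 * x) * prob ?B"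
    using int by (subst Bochner_Integration.integral_add) auto
  also have "\<dots> \<le> x / 2 * (fourth_const G \<kappa> + 1) + 1 / (2 * x) * x\<^sup>2"
  proof (intro add_mono mult_left_mono)
    show "expectation (\<lambda>w. \<bar>(N V1 j w)\<^sup>2 - 1\<bar> ^ 2) \<le> fourth_const G \<kappa> + 1"
      using expectation_abs_deviation(2)[OF V(1,2,4), of 2] N_fourth_moment[OF V(1,2,4)] by simp
  qed (use assms in auto)
  also have "\<dots> = (fourth_const G \<kappa> + 2) / 2 * x"
    using \<open>x > 0\<close> by (simp add: field_simps power2_eq_square)
  finally show ?thesis .
qed

section \<open>Independence between rows and between disjoint column sets, and moments of the
  excess\<close>

lemma excess_indep:
  assumes "V1 \<subseteq> C" "V2 \<subseteq> C"
  shows "indep_vars (\<lambda>_. borel) (excess V1 V2 a) J"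
proof -
  \<comment> \<open>\<open>h\<close> recovers the row sums from the array restricted to
    \<open>{j} \<times> C\<close>, so the excess is a measurable function of that block. Blocks of
    different rows are disjoint, whether or not \<open>V1\<close> and \<open>V2\<close>
    meet.\<close>
  define h where "h V j x = (\<Sum>c\<in>V. x (j, c)) / sqrt (2 * real (card V))"
    for V and j :: nat and x :: "nat \<times> nat \<Rightarrow> real"
  have h: "h V j \<in> borel_measurable (PiM ({j} \<times> C) (\<lambda>_. borel))" if "V \<subseteq> C" for V j
    unfolding h_def using that
    by (intro borel_measurable_divide borel_measurable_sum borel_measurable_const
        measurable_component_singleton) auto
  have "indep_vars (\<lambda>j. PiM ({j} \<times> C) (\<lambda>_. borel)) (\<lambda>j w. restrict (\<lambda>i. D i w) ({j} \<times> C)) J"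
    using indep by (rule indep_vars_restrict) (auto simp: disjoint_family_on_def)
  then have "indep_vars (\<lambda>_. borel)
      (\<lambda>j w. ((h V1 j (restrict (\<lambda>i. D i w) ({j} \<times> C)))\<^sup>2 - 1) *
        of_bool (a \<le> \<bar>h V2 j (restrict (\<lambda>i. D i w) ({j} \<times> C))\<bar>)) J"
  proof (rule indep_vars_compose2)
    fix j
    note [measurable] = h[OF assms(1), of j] h[OF assms(2), of j]
    show "(\<lambda>x. ((h V1 j x)\<^sup>2 - 1) * of_bool (a \<le> \<bar>h V2 j x\<bar>)) \<in> borel_measurable (PiM ({j} \<times> C) (\<lambda>_. borel))"
      unfolding of_bool_def by measurable
  qed
  moreover have "h V j (restrict (\<lambda>i. D i w) ({j} \<times> C)) = N V j w" if "V \<subseteq> C" for V j w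
    unfolding h_def N_def using that by (intro arg_cong2[where f = "(/)"] sum.cong) auto
  ultimately show ?thesis
    using assms by (simp add: excess_def[abs_def])
qed

lemma N_indep:
  assumes "V1 \<subseteq> C" "V2 \<subseteq> C" "V1 \<inter> V2 = {}" "j \<in> J"
  shows "indep_var borel (N V1 j) borel (N V2 j)"
proof -
  define h where "h V x = (\<Sum>c\<in>V. x (j, c)) / sqrt (2 * real (card V))"
    for V and x :: "nat \<times> nat \<Rightarrow> real"
  have h: "h V \<in> borel_measurable (PiM ({j} \<times> V) (\<lambda>_. borel))" for V
    unfolding h_def
    by (intro borel_measurable_divide borel_measurable_sum borel_measurable_const
        measurable_component_singleton) auto
  have *: "h V \<circ> (\<lambda>w. restrict (\<lambda>i. D i w) ({j} \<times> V)) = N V j" for V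
    by (auto simp: h_def N_def fun_eq_iff intro!: arg_cong2[where f = "(/)"] sum.cong)
  have "indep_var (PiM ({j} \<times> V1) (\<lambda>_. borel)) (\<lambda>w. restrict (\<lambda>i. D i w) ({j} \<times> V1))
      (PiM ({j} \<times> V2) (\<lambda>_. borel)) (\<lambda>w. restrict (\<lambda>i. D i w) ({j} \<times> V2))"
    using assms by (intro indep_var_restrict[OF indep]) auto
  from indep_var_compose[OF this h h] show ?thesis
    unfolding * .
qed

text \<open>Row sums over disjoint column sets are independent, so the expectation factors. The
  bound \<open>k >= 1\<close> matters: a positive power of the selection indicator is the indicator
  itself, whereas its power 0 is 1.\<close>

lemma excess_power_expectation:
  assumes V: "V1 \<subseteq> C" "V1 \<noteq> {}" "V2 \<subseteq> C" "j \<in> J" and "V1 \<inter> V2 = {}" "k \<ge> 1"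
  shows "expectation (\<lambda>w. excess V1 V2 a j w ^ k) =
    expectation (\<lambda>w. ((N V1 j w)\<^sup>2 - 1) ^ k) * prob {w \<in> space M. a \<le> \<bar>N V2 j w\<bar>}"
proof -
  note [measurable] = N_measurable[OF V(1,4)] N_measurable[OF V(3,4)]
  let ?B = "{w \<in> space M. a \<le> \<bar>N V2 j w\<bar>}"
  have ind: "indep_var borel (\<lambda>w. ((N V1 j w)\<^sup>2 - 1) ^ k) borel (\<lambda>w. indicator {x. a \<le> \<bar>x\<bar>} (N V2 j w) :: real)"
    by (rule indep_var_compose[OF N_indep[OF V(1,3) assms(5) V(4)],
        of "\<lambda>x. (x\<^sup>2 - 1) ^ k" borel "indicator {x. a \<le> \<bar>x\<bar>}" borel, unfolded comp_def]) auto
  have int: "integrable M (\<lambda>w. ((N V1 j w)\<^sup>2 - 1) ^ k)"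
    by (rule Bochner_Integration.integrable_bound[OF expectation_abs_deviation(1)[OF V(1,2,4), of k]])
      (auto simp: power_abs)
  have "expectation (\<lambda>w. excess V1 V2 a j w ^ k) =
      expectation (\<lambda>w. ((N V1 j w)\<^sup>2 - 1) ^ k * indicator {x. a \<le> \<bar>x\<bar>} (N V2 j w))"
    using assms(6) by (intro Bochner_Integration.integral_cong)
      (auto simp: excess_def of_bool_def indicator_def power_mult_distrib zero_power)
  also have "\<dots> = expectation (\<lambda>w. ((N V1 j w)\<^sup>2 - 1) ^ k) * expectation (\<lambda>w. indicator {x. a \<le> \<bar>x\<bar>} (N V2 j w))"
    by (rule indep_var_lebesgue_integral[OF ind int])
      (auto intro!: integrable_const_bound[where B = 1])
  also have "expectation (\<lambda>w. indicator {x. a \<le> \<bar>x\<bar>} (N V2 j w)) = expectation (indicator ?B)"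
    by (intro Bochner_Integration.integral_cong) (auto simp: indicator_def)
  finally show ?thesis by simp
qed

text \<open>The gain from splitting the sample: \<open>N^2 - 1\<close> is centred because
  \<open>N\<close> has unit variance, and an independent selection event cannot change that.\<close>

lemma excess_mean_zero:
  assumes "V1 \<subseteq> C" "V1 \<noteq> {}" "V2 \<subseteq> C" "j \<in> J" "V1 \<inter> V2 = {}"
  shows "expectation (excess V1 V2 a j) = 0"
proof -
  have "expectation (\<lambda>w. ((N V1 j w)\<^sup>2 - 1)) = 0"
    using integrable_N[OF assms(1,2,4), of 2] expectation_N_square[OF assms(1,2,4)]
    by (subst Bochner_Integration.integral_diff) (auto simp: prob_space)
  then show ?thesis
    using excess_power_expectation[OF assms, of 1 a] by simp
qed

lemma excess_second_moment:
  assumes V: "V1 \<subseteq> C" "V1 \<noteq> {}" "V2 \<subseteq> C" "V1 \<inter> V2 = {}"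
    and q: "\<And>j. j \<in> J \<Longrightarrow> prob {w \<in> space M. a \<le> \<bar>N V2 j w\<bar>} \<le> q"
  shows "expectation (\<lambda>w. (\<Sum>j\<in>J. excess V1 V2 a j w)\<^sup>2) \<le> real (card J) * ((fourth_const G \<kappa> + 1) * q)"
proof -
  have "expectation (\<lambda>w. (\<Sum>j\<in>J. excess V1 V2 a j w)\<^sup>2) = (\<Sum>j\<in>J. expectation (\<lambda>w. (excess V1 V2 a j w)\<^sup>2))"
    using V finite_J by (intro indep_sum_second_moment excess_indep integrable_excess_power excess_mean_zero)
  also have "\<dots> \<le> real (card J) * ((fourth_const G \<kappa> + 1) * q)"
  proof (rule sum_bounded_above)
    fix j assume j: "j \<in> J"
    have "expectation (\<lambda>w. ((N V1 j w)\<^sup>2 - 1)\<^sup>2) \<le> fourth_const G \<kappa> + 1"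
      using expectation_abs_deviation(2)[OF V(1,2) j, of 2] N_fourth_moment[OF V(1,2) j] by simp
    then show "expectation (\<lambda>w. (excess V1 V2 a j w)\<^sup>2) \<le> (fourth_const G \<kappa> + 1) * q"
      using excess_power_expectation[OF V(1-3) j V(4), of 2 a] q[OF j]
      by (auto intro!: mult_mono intro: order_trans[OF _ \<open>_ \<le> fourth_const G \<kappa> + 1\<close>] simp: fourth_const_def)
  qed
  finally show ?thesis .
qed

text \<open>A Bernstein-type moment condition. The prefactor \<open>q\<close> is essential: with
  \<open>q = (s / card J)^2\<close> the sum of such bounds over all coordinates is of order s and
  not of order \<open>card J\<close>.\<close>

lemma excess_moment_gaussian:
  assumes V: "V1 \<subseteq> C" "V1 \<noteq> {}" "V2 \<subseteq> C" "j \<in> J" "V1 \<inter> V2 = {}"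
    and k: "k \<ge> 1" "(2 * real k) powr (6 * \<kappa> + 3) \<le> real (card V1)"
    and q: "prob {w \<in> space M. a \<le> \<bar>N V2 j w\<bar>} \<le> q"
  shows "\<bar>expectation (\<lambda>w. excess V1 V2 a j w ^ k)\<bar> \<le> q * deviation_const G \<kappa> ^ k * fact k"
proof -
  have "\<bar>expectation (\<lambda>w. ((N V1 j w)\<^sup>2 - 1) ^ k)\<bar> \<le> expectation (\<lambda>w. \<bar>(N V1 j w)\<^sup>2 - 1\<bar> ^ k)"
    unfolding power_abs[symmetric] by (rule integral_abs_bound)
  also have "\<dots> \<le> (gauss_const G \<kappa> * real k) ^ k + 1"
    using expectation_abs_deviation(2)[OF V(1,2,4), of k] N_moment_gaussian[OF V(1,2,4) k] by simp
  also have "\<dots> \<le> ((gauss_const G \<kappa> + 1) ^ k) * real k ^ k"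
  proof -
    have "gauss_const G \<kappa> ^ k + 1 \<le> (gauss_const G \<kappa> + 1) ^ k"
    proof -
      obtain l where l: "k = Suc l" using k by (cases k) auto
      have "gauss_const G \<kappa> ^ k + 1 \<le> gauss_const G \<kappa> * (gauss_const G \<kappa> + 1) ^ l + 1 * (gauss_const G \<kappa> + 1) ^ l"
        unfolding l power_Suc using consts_pos by (intro add_mono mult_left_mono power_mono) auto
      then show ?thesis by (simp add: l algebra_simps)
    qed
    then have "(gauss_const G \<kappa> ^ k + 1) * real k ^ k \<le> (gauss_const G \<kappa> + 1) ^ k * real k ^ k"
      by (intro mult_right_mono) auto
    moreover have "1 \<le> real k ^ k" using k by (intro one_le_power) auto
    ultimately show ?thesis by (simp add: power_mult_distrib algebra_simps)
  qed
  also have "\<dots> \<le> (gauss_const G \<kappa> + 1) ^ k * (exp 1 ^ k * fact k)"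
    using power_self_le_exp_fact[of k] consts_pos
    by (intro mult_left_mono) (simp_all flip: exp_of_nat_mult)
  also have "\<dots> = deviation_const G \<kappa> ^ k * fact k"
    by (simp add: deviation_const_def power_mult_distrib)
  finally have "\<bar>expectation (\<lambda>w. ((N V1 j w)\<^sup>2 - 1) ^ k)\<bar> \<le> deviation_const G \<kappa> ^ k * fact k" .
  then have "\<bar>expectation (\<lambda>w. ((N V1 j w)\<^sup>2 - 1) ^ k)\<bar> * prob {w \<in> space M. a \<le> \<bar>N V2 j w\<bar>}
      \<le> (deviation_const G \<kappa> ^ k * fact k) * q"
    using q consts_pos by (intro mult_mono) (auto simp: deviation_const_def)
  then show ?thesis
    using excess_power_expectation[OF V k(1), of a] by (simp add: abs_mult mult_ac)
qed

text \<open>The Cauchy estimate over the coordinates, at a radius with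
  \<open>z * deviation_const <= 1/2\<close>, so that the terms from k = 2 on are dominated by a
  geometric series. Powers of the excess up to \<open>2 m\<close> involve moments of
  \<open>N\<close> up to order \<open>4 m\<close>, whence the demand on
  \<open>card V1\<close>.\<close>

lemma excess_sum_moment:
  assumes V: "V1 \<subseteq> C" "V1 \<noteq> {}" "V2 \<subseteq> C" "V1 \<inter> V2 = {}"
    and m: "(4 * real m) powr (6 * \<kappa> + 3) \<le> real (card V1)"
    and q: "\<And>j. j \<in> J \<Longrightarrow> prob {w \<in> space M. a \<le> \<bar>N V2 j w\<bar>} \<le> q" "q \<ge> 0"
    and z: "z > 0" "z * deviation_const G \<kappa> \<le> 1 / 2"
  shows "expectation (\<lambda>w. (\<Sum>j\<in>J. excess V1 V2 a j w) ^ (2 * m))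
    \<le> fact (2 * m) / z ^ (2 * m) * exp (real (card J) * (2 * q * (z * deviation_const G \<kappa>)\<^sup>2))"
proof -
  define F where "F = exp (2 * q * (z * deviation_const G \<kappa>)\<^sup>2)"
  have dc: "deviation_const G \<kappa> > 0" using consts_pos by (simp add: deviation_const_def)
  have series: "(\<Sum>k\<le>2*m. z ^ k * \<bar>expectation (\<lambda>w. excess V1 V2 a j w ^ k)\<bar> / fact k) \<le> F"
    if j: "j \<in> J" for j
  proof -
    let ?f = "\<lambda>k. z ^ k * \<bar>expectation (\<lambda>w. excess V1 V2 a j w ^ k)\<bar> / fact k"
    have "(\<Sum>k\<le>2*m. ?f k) \<le> (\<Sum>k\<in>{0,1} \<union> {2..2*m}. ?f k)"
      using z by (intro sum_mono2) auto
    also have "\<dots> = (\<Sum>k\<in>{0,1}. ?f k) + (\<Sum>k=2..2*m. ?f k)"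
      by (rule sum.union_disjoint) auto
    also have "(\<Sum>k\<in>{0,1}. ?f k) = 1"
      using excess_mean_zero[OF V(1-3) j V(4)] by (simp add: prob_space)
    also have "(\<Sum>k=2..2*m. ?f k) \<le> (\<Sum>k=2..2*m. q * (z * deviation_const G \<kappa>)\<^sup>2 * (1 / 2) ^ (k - 2))"
    proof (rule sum_mono)
      fix k assume k: "k \<in> {2..2*m}"
      have "(2 * real k) powr (6 * \<kappa> + 3) \<le> (4 * real m) powr (6 * \<kappa> + 3)"
        using k \<kappa> by (intro powr_mono2) auto
      then have "\<bar>expectation (\<lambda>w. excess V1 V2 a j w ^ k)\<bar> \<le> q * deviation_const G \<kappa> ^ k * fact k"
        using k m q(1)[OF j] by (intro excess_moment_gaussian V j) auto
      then have "?f k \<le> z ^ k * (q * deviation_const G \<kappa> ^ k * fact k) / fact k"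
        using z by (intro divide_right_mono mult_left_mono) auto
      also have "\<dots> = q * (z * deviation_const G \<kappa>) ^ k"
        by (simp add: power_mult_distrib)
      also have "\<dots> = q * ((z * deviation_const G \<kappa>)\<^sup>2 * (z * deviation_const G \<kappa>) ^ (k - 2))"
        using k by (metis atLeastAtMost_iff le_add_diff_inverse power_add)
      also have "\<dots> \<le> q * ((z * deviation_const G \<kappa>)\<^sup>2 * (1 / 2) ^ (k - 2))"
        using z q dc by (intro mult_left_mono power_mono) auto
      finally show "?f k \<le> q * (z * deviation_const G \<kappa>)\<^sup>2 * (1 / 2) ^ (k - 2)" by simp
    qed
    also have "\<dots> \<le> q * (z * deviation_const G \<kappa>)\<^sup>2 * 2"
      unfolding sum_distrib_left[symmetric] using q sum_half_powers_le by (intro mult_left_mono) auto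
    also have "1 + q * (z * deviation_const G \<kappa>)\<^sup>2 * 2 \<le> F"
      using exp_ge_add_one_self[of "2 * q * (z * deviation_const G \<kappa>)\<^sup>2"] by (simp add: F_def mult_ac)
    finally show ?thesis by simp
  qed
  have int: "integrable M (\<lambda>w. excess V1 V2 a j w ^ k)" if "j \<in> J" for j k
    using V that by (intro integrable_excess_power)
  have "\<bar>expectation (\<lambda>w. (\<Sum>j\<in>J. excess V1 V2 a j w) ^ (2 * m))\<bar>
      \<le> fact (2 * m) / z ^ (2 * m) * prod (\<lambda>_. F) J"
    using indep_sum_moment[OF finite_J excess_indep[OF V(1,3)] int z(1) series] by auto
  also have "prod (\<lambda>_. F) J = exp (real (card J) * (2 * q * (z * deviation_const G \<kappa>)\<^sup>2))"
    by (simp add: F_def flip: exp_of_nat_mult)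
  finally show ?thesis by simp
qed

section \<open>Rejection and acceptance probabilities at a single scale\<close>

context
  fixes V1 V2 :: "nat set" and a :: real and s :: nat
  assumes V: "V1 \<subseteq> C" "V1 \<noteq> {}" "V2 \<subseteq> C" "V2 \<noteq> {}"
    and s: "1 \<le> s" "s \<le> card J"
    and tail: "\<And>j. j \<in> J \<Longrightarrow> prob {w \<in> space M. a \<le> \<bar>N V2 j w\<bar>} \<le> (real s / real (card J))\<^sup>2"
begin

lemma excess_sum_measurable [measurable]:
  "(\<lambda>w. \<Sum>j\<in>J. excess V1 V2 a j w) \<in> borel_measurable M"
  using V by (intro borel_measurable_sum excess_measurable)

lemma expectation_sum_abs_excess:
  "expectation (\<lambda>w. \<Sum>j\<in>J. \<bar>excess V1 V2 a j w\<bar>) \<le> (fourth_const G \<kappa> + 2) / 2 * real s"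
proof -
  have "expectation (\<lambda>w. \<Sum>j\<in>J. \<bar>excess V1 V2 a j w\<bar>) = (\<Sum>j\<in>J. expectation (\<lambda>w. \<bar>excess V1 V2 a j w\<bar>))"
    using integrable_excess_power(2)[OF V(1-3), of _ a 1] by (intro Bochner_Integration.integral_sum) simp
  also have "\<dots> \<le> real (card J) * ((fourth_const G \<kappa> + 2) / 2 * (real s / real (card J)))"
    using s tail by (intro sum_bounded_above expectation_abs_excess V) auto
  finally show ?thesis using s by simp
qed

text \<open>First absolute moments only, so \<open>V1 = V2\<close> is covered; this is the bound for
  t = 1.\<close>

lemma null_rejection_markov:
  assumes "r > 0"
  shows "prob {w \<in> space M. r < (\<Sum>j\<in>J. excess V1 V2 a j w)} \<le> (fourth_const G \<kappa> + 2) / 2 * real s / r"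
proof -
  note [measurable] = excess_measurable[OF V(1,3)]
  have int: "integrable M (\<lambda>w. \<Sum>j\<in>J. \<bar>excess V1 V2 a j w\<bar>)"
    using integrable_excess_power(2)[OF V(1-3), of _ a 1] by (intro Bochner_Integration.integrable_sum) simp
  then have [measurable]: "(\<lambda>w. \<Sum>j\<in>J. \<bar>excess V1 V2 a j w\<bar>) \<in> borel_measurable M"
    by simp
  have "prob {w \<in> space M. r < (\<Sum>j\<in>J. excess V1 V2 a j w)} \<le> prob {w \<in> space M. r \<le> (\<Sum>j\<in>J. \<bar>excess V1 V2 a j w\<bar>)}"
  proof (rule finite_measure_mono)
    have "(\<Sum>j\<in>J. excess V1 V2 a j w) \<le> (\<Sum>j\<in>J. \<bar>excess V1 V2 a j w\<bar>)" for w
      by (intro sum_mono) auto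
    then show "{w \<in> space M. r < (\<Sum>j\<in>J. excess V1 V2 a j w)} \<subseteq> {w \<in> space M. r \<le> (\<Sum>j\<in>J. \<bar>excess V1 V2 a j w\<bar>)}"
      by (auto intro: less_imp_le order.strict_trans2)
  qed measurable
  also have "\<dots> \<le> expectation (\<lambda>w. \<Sum>j\<in>J. \<bar>excess V1 V2 a j w\<bar>) / r"
    using int assms by (intro integral_Markov_inequality_measure[where A = "{}"]) (auto intro!: sum_nonneg)
  also have "\<dots> \<le> (fourth_const G \<kappa> + 2) / 2 * real s / r"
    using expectation_sum_abs_excess assms by (intro divide_right_mono) auto
  finally show ?thesis .
qed

lemma null_rejection_even_power:
  assumes "r > 0"
  shows "prob {w \<in> space M. r < (\<Sum>j\<in>J. excess V1 V2 a j w)}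
    \<le> expectation (\<lambda>w. (\<Sum>j\<in>J. excess V1 V2 a j w) ^ (2 * m)) / r ^ (2 * m)"
proof -
  have "prob {w \<in> space M. r < (\<Sum>j\<in>J. excess V1 V2 a j w)}
      \<le> prob {w \<in> space M. r \<le> \<bar>\<Sum>j\<in>J. excess V1 V2 a j w\<bar>}"
    by (rule finite_measure_mono) (auto, measurable)
  also have "\<dots> \<le> expectation (\<lambda>w. (\<Sum>j\<in>J. excess V1 V2 a j w) ^ (2 * m)) / r ^ (2 * m)"
  proof (rule markov_even_power)
    show "integrable M (\<lambda>w. (\<Sum>j\<in>J. excess V1 V2 a j w) ^ (2 * m))"
      using indep_sum_moment[OF finite_J excess_indep[OF V(1,3), of a] integrable_excess_power(1)[OF V(1-3)],
          of 1 0 "\<lambda>_. 1"] by (simp add: prob_space)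
  qed (use assms in measurable)
  finally show ?thesis .
qed

text \<open>The excesses are independent and centred, and each has variance of order
  \<open>(s / card J)^2\<close>, so their sum has variance of order
  \<open>s * (s / card J) <= s\<close>.\<close>

lemma null_rejection_chebyshev:
  assumes "r > 0" "V1 \<inter> V2 = {}"
  shows "prob {w \<in> space M. r < (\<Sum>j\<in>J. excess V1 V2 a j w)} \<le> (fourth_const G \<kappa> + 1) * real s / r\<^sup>2"
proof -
  have "expectation (\<lambda>w. (\<Sum>j\<in>J. excess V1 V2 a j w)\<^sup>2)
      \<le> real (card J) * ((fourth_const G \<kappa> + 1) * (real s / real (card J))\<^sup>2)"
    using excess_second_moment[OF V(1-3) assms(2) tail] .
  also have "\<dots> = (fourth_const G \<kappa> + 1) * real s * (real s / real (card J))"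
    using s by (simp add: power2_eq_square)
  also have "\<dots> \<le> (fourth_const G \<kappa> + 1) * real s * 1"
    using s by (intro mult_left_mono) (auto simp: fourth_const_def)
  finally have "expectation (\<lambda>w. (\<Sum>j\<in>J. excess V1 V2 a j w)\<^sup>2) / r\<^sup>2 \<le> (fourth_const G \<kappa> + 1) * real s / r\<^sup>2"
    by (intro divide_right_mono) auto
  then show ?thesis
    using null_rejection_even_power[OF assms(1), of 1] by simp
qed

text \<open>Markov at the order \<open>2 m\<close>: every factor \<open>2 m / (z r)\<close> is at
  most \<open>12 * deviation_const / c\<close>. Of the \<open>2 m\<close> copies, m are bounded by
  \<open>exp (-3)\<close> each and beat the \<open>exp l\<close> coming from the product over the
  coordinates; one more survives as the prefactor, which can be made small through
  \<open>c\<close>.\<close>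

lemma null_rejection_exponential:
  assumes "V1 \<inter> V2 = {}" "l \<ge> 1 / 2" "c > 0"
    and r: "r \<ge> c * (sqrt (real s * l) + l)"
    and large: "(12 * l) powr (6 * \<kappa> + 3) \<le> real (card V1)"
    and eta: "12 * deviation_const G \<kappa> / c \<le> exp (- 3)"
  shows "prob {w \<in> space M. r < (\<Sum>j\<in>J. excess V1 V2 a j w)} \<le> 12 * deviation_const G \<kappa> / c * exp (- l)"
proof -
  \<comment> \<open>\<open>l >= 1/2\<close> yields \<open>m <= l + 1 <= 3 l\<close>; therefore
    \<open>4 m <= 12 l\<close>, the quantity in \<open>large\<close>.\<close>
  define m where "m = nat \<lceil>l\<rceil>"
  have m: "l \<le> real m" "real m \<le> 3 * l" "m \<ge> 1"
    using assms(2) by (auto simp: m_def) linarith+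
  have dc: "deviation_const G \<kappa> > 0" using consts_pos by (simp add: deviation_const_def)
  \<comment> \<open>The radius up to a constant: the largest \<open>u <= 1\<close> with
    \<open>s * u^2 <= l\<close>, which keeps the product over the coordinates below
    \<open>exp l\<close>. The two parts of r match the two cases of the minimum and give
    \<open>c * l <= u * r\<close>.\<close>
  define u where "u = min 1 (sqrt (l / real s))"
  define z where "z = u / (2 * deviation_const G \<kappa>)"
  have u: "u > 0" using assms(2) s by (simp add: u_def)
  then have z: "z > 0" "z * deviation_const G \<kappa> = u / 2" using dc by (simp_all add: z_def)
  have "sqrt (l / real s) * sqrt (real s * l) = l"
    using s assms(2) by (simp flip: real_sqrt_mult)
  then have "l \<le> u * (sqrt (real s * l) + l)"
    using assms(2) s by (auto simp: u_def min_def distrib_left intro!: add_increasing2)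
  also have "\<dots> \<le> u * (r / c)"
    using r u \<open>c > 0\<close> by (intro mult_left_mono) (auto simp: field_simps)
  finally have ul: "c * l \<le> u * r" using \<open>c > 0\<close> by (simp add: field_simps)
  then have "u * r > 0" using assms(2,3) by (smt (verit) mult_pos_pos divide_pos_pos)
  then have rpos: "r > 0" using u by (simp add: zero_less_mult_iff)
  have us: "real s * u\<^sup>2 \<le> l"
  proof -
    have "u\<^sup>2 \<le> (sqrt (l / real s))\<^sup>2" using u by (intro power_mono) (auto simp: u_def)
    also have "\<dots> = l / real s" using assms(2) by simp
    finally show ?thesis using s by (simp add: field_simps)
  qed
  have "(4 * real m) powr (6 * \<kappa> + 3) \<le> (12 * l) powr (6 * \<kappa> + 3)"
    using m \<kappa> by (intro powr_mono2) auto
  then have V1: "(4 * real m) powr (6 * \<kappa> + 3) \<le> real (card V1)" using large by simp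
  have "expectation (\<lambda>w. (\<Sum>j\<in>J. excess V1 V2 a j w) ^ (2 * m)) \<le> fact (2 * m) / z ^ (2 * m) *
      exp (real (card J) * (2 * (real s / real (card J))\<^sup>2 * (z * deviation_const G \<kappa>)\<^sup>2))"
    using u by (intro excess_sum_moment V assms(1) V1 tail z) (auto simp: z(2), auto simp: u_def)
  also have "\<dots> \<le> real (2 * m) ^ (2 * m) / z ^ (2 * m) * exp l"
  proof (intro mult_mono divide_right_mono fact_le_power_self)
    have "real (card J) * (2 * (real s / real (card J))\<^sup>2 * (z * deviation_const G \<kappa>)\<^sup>2) =
        real s * u\<^sup>2 * (real s / real (card J)) / 2"
      unfolding z(2) using s by (simp add: power2_eq_square mult_ac)
    also have "\<dots> \<le> l * 1 / 2"
      using us s assms(2) by (intro divide_right_mono mult_mono) auto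
    also have "\<dots> \<le> l" using assms(2) by simp
    finally show "exp (real (card J) * (2 * (real s / real (card J))\<^sup>2 * (z * deviation_const G \<kappa>)\<^sup>2)) \<le> exp l"
      by simp
  qed (use z in auto)
  finally have "expectation (\<lambda>w. (\<Sum>j\<in>J. excess V1 V2 a j w) ^ (2 * m)) / r ^ (2 * m)
      \<le> real (2 * m) ^ (2 * m) / z ^ (2 * m) * exp l / r ^ (2 * m)"
    using rpos by (intro divide_right_mono) auto
  also have "\<dots> = (real (2 * m) / (z * r)) ^ (2 * m) * exp l"
    by (simp add: power_divide power_mult_distrib)
  also have "\<dots> \<le> (12 * deviation_const G \<kappa> / c) ^ (2 * m) * exp l"
  proof (intro mult_right_mono power_mono)
    have "real (2 * m) * c \<le> 6 * (c * l)" using m \<open>c > 0\<close> by (simp add: mult_ac)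
    also have "\<dots> \<le> 6 * (u * r)" using ul by simp
    finally show "real (2 * m) / (z * r) \<le> 12 * deviation_const G \<kappa> / c"
      using dc u rpos \<open>c > 0\<close> by (simp add: z_def field_simps)
  qed (use z rpos in auto)
  also have "\<dots> = (12 * deviation_const G \<kappa> / c) ^ m * (12 * deviation_const G \<kappa> / c) ^ m * exp l"
    by (simp add: mult_2 power_add)
  also have "\<dots> \<le> (12 * deviation_const G \<kappa> / c) ^ 1 * exp (- 3) ^ m * exp l"
  proof (intro mult_right_mono mult_mono power_decreasing power_mono)
    show "12 * deviation_const G \<kappa> / c \<le> 1" using eta by (rule order_trans) simp
  qed (use m dc \<open>c > 0\<close> eta in auto)
  also have "exp (- 3 :: real) ^ m = exp (- 3 * real m)"
    by (simp add: mult.commute flip: exp_of_nat_mult)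
  also have "(12 * deviation_const G \<kappa> / c) ^ 1 * exp (- 3 * real m) * exp l = 12 * deviation_const G \<kappa> / c * exp (l - 3 * real m)"
    by (simp add: exp_diff exp_minus field_simps)
  also have "\<dots> \<le> 12 * deviation_const G \<kappa> / c * exp (- l)"
    using m dc \<open>c > 0\<close> assms(2) by (intro mult_left_mono) auto
  finally show ?thesis
    using null_rejection_even_power[OF rpos, of m] by linarith
qed

text \<open>A pointwise lower bound. A coordinate of \<open>S\<close> is either selected, and then
  \<open>(\<delta> + N1)^2 >= \<delta>^2 / 2 - N1^2\<close>, or missed, and then
  \<open>\<delta>^2 / 2 <= a^2 + N2^2\<close>, so that little is lost. Off \<open>S\<close> the
  summand is the null excess. The random losses are collected in \<open>R\<close>, whose mean is of
  order s; nothing here asks \<open>V1\<close> and \<open>V2\<close> to be disjoint, so t = 1 is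
  included.\<close>

lemma alternative_acceptance:
  fixes \<delta> :: "nat \<Rightarrow> real" and S :: "nat set"
  defines "Q \<equiv> (\<Sum>j\<in>S. (\<delta> j)\<^sup>2)"
  assumes S: "S \<subseteq> J" "card S \<le> s" "\<And>j. j \<in> J - S \<Longrightarrow> \<delta> j = 0"
    and Q: "Q > 0" "real s * (2 * a\<^sup>2 + 1) + r \<le> Q / 4" and a: "a \<ge> 0"
  shows "prob {w \<in> space M. (\<Sum>j\<in>J. ((\<delta> j + N V1 j w)\<^sup>2 - 1) * of_bool (a \<le> \<bar>\<delta> j + N V2 j w\<bar>)) \<le> r}
    \<le> 4 * ((fourth_const G \<kappa> + 8) / 2 * real s) / Q"
proof -
  define R where "R w = (\<Sum>j\<in>S. 2 * (N V2 j w)\<^sup>2 + (N V1 j w)\<^sup>2) + (\<Sum>j\<in>J. \<bar>excess V1 V2 a j w\<bar>)" for w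
  have intN: "integrable M (\<lambda>w. 2 * (N V2 j w)\<^sup>2 + (N V1 j w)\<^sup>2)" if "j \<in> S" for j
    using integrable_N[OF V(1,2), of j 2] integrable_N[OF V(3,4), of j 2] that S(1) by auto
  have intE: "integrable M (\<lambda>w. \<Sum>j\<in>J. \<bar>excess V1 V2 a j w\<bar>)"
    using integrable_excess_power(2)[OF V(1-3), of _ a 1] by (intro Bochner_Integration.integrable_sum) simp
  have intR: "integrable M R"
    unfolding R_def by (rule Bochner_Integration.integrable_add[OF Bochner_Integration.integrable_sum[OF intN] intE])
  have [measurable]: "R \<in> borel_measurable M" using intR by simp
  have "expectation R = expectation (\<lambda>w. \<Sum>j\<in>S. 2 * (N V2 j w)\<^sup>2 + (N V1 j w)\<^sup>2)
      + expectation (\<lambda>w. \<Sum>j\<in>J. \<bar>excess V1 V2 a j w\<bar>)"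
    unfolding R_def by (rule Bochner_Integration.integral_add[OF Bochner_Integration.integrable_sum[OF intN] intE])
  also have "expectation (\<lambda>w. \<Sum>j\<in>S. 2 * (N V2 j w)\<^sup>2 + (N V1 j w)\<^sup>2) =
      (\<Sum>j\<in>S. expectation (\<lambda>w. 2 * (N V2 j w)\<^sup>2 + (N V1 j w)\<^sup>2))"
    using intN by (rule Bochner_Integration.integral_sum)
  also have "(\<Sum>j\<in>S. expectation (\<lambda>w. 2 * (N V2 j w)\<^sup>2 + (N V1 j w)\<^sup>2)) = (\<Sum>j\<in>S. 3)"
  proof (rule sum.cong[OF refl])
    fix j assume "j \<in> S"
    then have j: "j \<in> J" using S(1) by auto
    show "expectation (\<lambda>w. 2 * (N V2 j w)\<^sup>2 + (N V1 j w)\<^sup>2) = 3"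
      using integrable_N[OF V(1,2) j, of 2] integrable_N[OF V(3,4) j, of 2]
        expectation_N_square[OF V(1,2) j] expectation_N_square[OF V(3,4) j]
      by (subst Bochner_Integration.integral_add) auto
  qed
  also have "(\<Sum>j\<in>S. 3) + expectation (\<lambda>w. \<Sum>j\<in>J. \<bar>excess V1 V2 a j w\<bar>)
      \<le> 3 * real s + (fourth_const G \<kappa> + 2) / 2 * real s"
    using S(2) expectation_sum_abs_excess by (intro add_mono) auto
  also have "\<dots> = (fourth_const G \<kappa> + 8) / 2 * real s"
    by (simp add: field_simps)
  finally have ER: "expectation R \<le> (fourth_const G \<kappa> + 8) / 2 * real s" .
  have lower: "Q / 2 - real s * (2 * a\<^sup>2 + 1) - R w \<le>
      (\<Sum>j\<in>J. ((\<delta> j + N V1 j w)\<^sup>2 - 1) * of_bool (a \<le> \<bar>\<delta> j + N V2 j w\<bar>))" for w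
  proof -
    let ?A = "\<lambda>j. ((\<delta> j + N V1 j w)\<^sup>2 - 1) * of_bool (a \<le> \<bar>\<delta> j + N V2 j w\<bar>)"
    let ?B = "\<lambda>j. (\<delta> j)\<^sup>2 / 2 - (2 * a\<^sup>2 + 1) - (2 * (N V2 j w)\<^sup>2 + (N V1 j w)\<^sup>2)"
    \<comment> \<open>The right side minus the left side is \<open>(x + 2 y)^2 / 2\<close>.\<close>
    have half: "x\<^sup>2 / 2 \<le> (x + y)\<^sup>2 + y\<^sup>2" for x y :: real
      using zero_le_power2[of "x / 2 + y"] zero_le_power2[of "x + 2 * y"] by (simp add: power2_eq_square algebra_simps)
    have 1: "?B j \<le> ?A j" for j
    proof (cases "a \<le> \<bar>\<delta> j + N V2 j w\<bar>")
      case True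
      then show ?thesis
        using half[of "\<delta> j" "N V1 j w"] zero_le_power2[of a] zero_le_power2[of "N V2 j w"]
        by (simp only: of_bool_def if_True mult_1_right)
    next
      case False
      then have "(\<delta> j + N V2 j w)\<^sup>2 \<le> a\<^sup>2"
        using a by (intro power2_le_iff_abs_le[THEN iffD2]) auto
      then have "(\<delta> j)\<^sup>2 / 2 \<le> a\<^sup>2 + (N V2 j w)\<^sup>2"
        using half[of "\<delta> j" "N V2 j w"] by linarith
      then show ?thesis
        using False zero_le_power2[of a] zero_le_power2[of "N V1 j w"] zero_le_power2[of "N V2 j w"]
        by (simp only: of_bool_def if_False mult_zero_right)
    qed
    have 2: "- \<bar>excess V1 V2 a j w\<bar> \<le> ?A j" if "j \<in> J - S" for j
      using S(3)[OF that] by (simp add: excess_def)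
    have "Q / 2 - real s * (2 * a\<^sup>2 + 1) - R w \<le> (\<Sum>j\<in>S. ?B j) + (\<Sum>j\<in>J. - \<bar>excess V1 V2 a j w\<bar>)"
    proof -
      have "real (card S) * (2 * a\<^sup>2 + 1) \<le> real s * (2 * a\<^sup>2 + 1)"
        using S(2) by (intro mult_right_mono) auto
      then show ?thesis
        by (simp add: R_def Q_def sum_subtractf sum_negf sum_divide_distrib[symmetric])
    qed
    also have "\<dots> \<le> (\<Sum>j\<in>S. ?A j) + (\<Sum>j\<in>J - S. ?A j)"
    proof (rule add_mono)
      have "(\<Sum>j\<in>J. - \<bar>excess V1 V2 a j w\<bar>) \<le> (\<Sum>j\<in>J - S. - \<bar>excess V1 V2 a j w\<bar>)"
        unfolding sum_negf using finite_J by (simp add: sum_mono2)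
      also have "\<dots> \<le> (\<Sum>j\<in>J - S. ?A j)" using 2 by (rule sum_mono)
      finally show "(\<Sum>j\<in>J. - \<bar>excess V1 V2 a j w\<bar>) \<le> (\<Sum>j\<in>J - S. ?A j)" .
    qed (use 1 in \<open>rule sum_mono\<close>)
    also have "\<dots> = (\<Sum>j\<in>J. ?A j)"
      using sum.subset_diff[OF S(1) finite_J, of ?A] by simp
    finally show ?thesis .
  qed
  have "prob {w \<in> space M. (\<Sum>j\<in>J. ((\<delta> j + N V1 j w)\<^sup>2 - 1) * of_bool (a \<le> \<bar>\<delta> j + N V2 j w\<bar>)) \<le> r}
      \<le> prob {w \<in> space M. Q / 4 \<le> R w}"
  proof (rule finite_measure_mono)
    show "{w \<in> space M. (\<Sum>j\<in>J. ((\<delta> j + N V1 j w)\<^sup>2 - 1) * of_bool (a \<le> \<bar>\<delta> j + N V2 j w\<bar>)) \<le> r}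
      \<subseteq> {w \<in> space M. Q / 4 \<le> R w}"
    proof safe
      fix w assume "(\<Sum>j\<in>J. ((\<delta> j + N V1 j w)\<^sup>2 - 1) * of_bool (a \<le> \<bar>\<delta> j + N V2 j w\<bar>)) \<le> r"
      then show "Q / 4 \<le> R w" using lower[of w] Q(2) by linarith
    qed
  qed measurable
  also have "\<dots> \<le> expectation R / (Q / 4)"
  proof (rule integral_Markov_inequality_measure[where A = "{}"])
    show "AE w in M. 0 \<le> R w"
      by (rule AE_I2) (auto simp: R_def intro!: add_nonneg_nonneg sum_nonneg)
  qed (use intR Q(1) in auto)
  also have "\<dots> \<le> (fourth_const G \<kappa> + 8) / 2 * real s / (Q / 4)"
    using ER Q(1) by (intro divide_right_mono) auto
  finally show ?thesis by (simp add: field_simps)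
qed

end

end

section \<open>The noise class and the test statistics\<close>

text \<open>\<open>powr_self_bound\<close> with \<open>u = |w / K|^\<alpha>\<close> and
  \<open>b = k / \<alpha>\<close> bounds \<open>|w|^k\<close> by a multiple of
  \<open>exp (|w / K|^\<alpha>)\<close>, whose mean is at most 2. That 2 is absorbed as
  \<open>2 ^ k\<close>, so the bound is a pure k-th power.\<close>

lemma noise_dist_moments:
  assumes D: "D \<in> noise_dists \<alpha> K" and "\<alpha> > 0" "K > 0" and k: "k \<ge> 1"
  shows "integrable D (\<lambda>w. w ^ k)"
    and "(\<integral>w. \<bar>w\<bar> ^ k \<partial>D) \<le> (2 * K * (1 / \<alpha>) powr (1 / \<alpha>) * real k powr (1 / \<alpha>)) ^ k"
proof -
  interpret prob_space D using D by (simp add: noise_dists_def)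
  have [measurable_cong]: "sets D = sets borel" using D by (simp add: noise_dists_def)
  define B where "B = (K * (1 / \<alpha>) powr (1 / \<alpha>) * real k powr (1 / \<alpha>)) ^ k"
  have B: "B > 0" using assms by (simp add: B_def)
  have bound: "\<bar>w\<bar> ^ k \<le> B * exp (\<bar>w / K\<bar> powr \<alpha>)" for w
  proof -
    have "\<bar>w / K\<bar> ^ k = (\<bar>w / K\<bar> powr \<alpha>) powr (real k / \<alpha>)"
      using assms by (cases "w = 0") (auto simp: powr_powr powr_realpow)
    also have "\<dots> \<le> (real k / \<alpha>) powr (real k / \<alpha>) * exp (\<bar>w / K\<bar> powr \<alpha>)"
      using assms by (intro powr_self_bound) auto
    also have "(real k / \<alpha>) powr (real k / \<alpha>) = ((1 / \<alpha>) powr (1 / \<alpha>) * real k powr (1 / \<alpha>)) ^ k"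
    proof -
      have "(real k / \<alpha>) powr (real k / \<alpha>) = ((1 / \<alpha> * real k) powr (1 / \<alpha>)) powr real k"
        by (simp add: powr_powr)
      also have "(1 / \<alpha> * real k) powr (1 / \<alpha>) = (1 / \<alpha>) powr (1 / \<alpha>) * real k powr (1 / \<alpha>)"
        by (rule powr_mult)
      finally show ?thesis
        using assms by (simp add: powr_realpow)
    qed
    finally have "K ^ k * \<bar>w / K\<bar> ^ k \<le>
        K ^ k * (((1 / \<alpha>) powr (1 / \<alpha>) * real k powr (1 / \<alpha>)) ^ k * exp (\<bar>w / K\<bar> powr \<alpha>))"
      using assms by (intro mult_left_mono) auto
    moreover have "K ^ k * \<bar>w / K\<bar> ^ k = \<bar>w\<bar> ^ k"
      using assms by (simp add: abs_divide power_divide)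
    ultimately show ?thesis by (simp add: B_def power_mult_distrib mult_ac)
  qed
  have "(\<integral>\<^sup>+w. ennreal (\<bar>w\<bar> ^ k) \<partial>D) \<le> (\<integral>\<^sup>+w. ennreal B * ennreal (exp (\<bar>w / K\<bar> powr \<alpha>)) \<partial>D)"
    using bound B by (intro nn_integral_mono) (simp flip: ennreal_mult)
  also have "\<dots> = ennreal B * (\<integral>\<^sup>+w. ennreal (exp (\<bar>w / K\<bar> powr \<alpha>)) \<partial>D)"
    by (rule nn_integral_cmult) measurable
  also have "\<dots> \<le> ennreal B * 2"
    using D by (intro mult_left_mono) (auto simp: noise_dists_def)
  also have "\<dots> = ennreal (B * 2)"
    using B by (simp add: ennreal_mult)
  finally have nn: "(\<integral>\<^sup>+w. ennreal (\<bar>w\<bar> ^ k) \<partial>D) \<le> ennreal (B * 2)" .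
  show int: "integrable D (\<lambda>w. w ^ k)"
    using order.strict_trans1[OF nn ennreal_less_top]
    by (intro integrableI_bounded) (auto simp: power_abs)
  then have "integrable D (\<lambda>w. \<bar>w\<bar> ^ k)"
    unfolding power_abs[symmetric] by (rule integrable_abs)
  then have "ennreal (\<integral>w. \<bar>w\<bar> ^ k \<partial>D) \<le> ennreal (B * 2)"
    using nn by (subst nn_integral_eq_integral[symmetric]) auto
  then have "(\<integral>w. \<bar>w\<bar> ^ k \<partial>D) \<le> B * 2"
    using B by (subst (asm) ennreal_le_iff) auto
  also have "\<dots> \<le> B * 2 ^ k"
    using B k self_le_power[of "2::real" k] by (intro mult_left_mono) auto
  finally show "(\<integral>w. \<bar>w\<bar> ^ k \<partial>D) \<le> (2 * K * (1 / \<alpha>) powr (1 / \<alpha>) * real k powr (1 / \<alpha>)) ^ k"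
    by (simp add: B_def power_mult_distrib mult_ac)
qed

text \<open>
  All statistics of the test are built from the differences of the columns \<open>c\<close> and \<open>n + 1 - c\<close>, so
  one independent array serves for all of them.
\<close>

definition contrast :: "nat \<Rightarrow> nat set \<Rightarrow> nat \<Rightarrow> (nat \<times> nat \<Rightarrow> real) \<Rightarrow> real" where
  "contrast n V j X = (\<Sum>c\<in>V. X (j, c) - X (j, n + 1 - c)) / sqrt (2 * real (card V))"

text \<open>\<open>8 = 2 * 2 * 2\<close>: from the exponential moment bound, from
  \<open>|x - y|^k <= 2^k (|x|^k + |y|^k)\<close>, and from the two summands there. A plain factor 2
  is each time enlarged to \<open>2 ^ k\<close>.\<close>

definition noise_scale :: "real \<Rightarrow> real \<Rightarrow> real" where
  "noise_scale \<alpha> K = 8 * K * (1 / \<alpha>) powr (1 / \<alpha>)"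

lemma abs_diff_power_le:
  fixes x y :: real
  shows "\<bar>x - y\<bar> ^ k \<le> 2 ^ k * (\<bar>x\<bar> ^ k + \<bar>y\<bar> ^ k)"
proof -
  have "\<bar>x - y\<bar> ^ k \<le> (2 * max \<bar>x\<bar> \<bar>y\<bar>) ^ k"
    by (intro power_mono) auto
  also have "\<dots> \<le> 2 ^ k * (\<bar>x\<bar> ^ k + \<bar>y\<bar> ^ k)"
    by (auto simp: power_mult_distrib max_def intro!: mult_left_mono)
  finally show ?thesis .
qed

text \<open>For \<open>c <= n div 2\<close> the sets \<open>{(j, c), (j, n + 1 - c)}\<close> are
  disjoint and have two elements, so the differences inherit independence and have variance 2. A
  middle column, present for odd n, belongs to no pair.\<close>

lemma noise_array_differences:
  assumes P: "P \<in> noise_laws \<alpha> K p n" and \<alpha>: "\<alpha> > 0" "\<alpha> \<le> 2" and K: "K > 0"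
  shows "noise_array P (\<lambda>i E. E i - E (fst i, n + 1 - snd i)) {1..p} {1..n div 2}
    (noise_scale \<alpha> K) (1 / \<alpha>)"
proof -
  interpret prob_space P using P by (simp add: noise_laws_def)
  have ind: "indep_vars (\<lambda>_. borel) (\<lambda>i E. E i) (cells p n)"
    and dist: "\<And>i. i \<in> cells p n \<Longrightarrow> distr P borel (\<lambda>E. E i) \<in> noise_dists \<alpha> K"
    using P by (auto simp: noise_laws_def)
  have rv [measurable]: "(\<lambda>E. E i) \<in> borel_measurable P" if "i \<in> cells p n" for i
    using ind that by (auto simp: indep_vars_def)
  define B where "B k = (2 * K * (1 / \<alpha>) powr (1 / \<alpha>) * real k powr (1 / \<alpha>)) ^ k" for k
  have int: "integrable P (\<lambda>E. E i ^ k)" if "i \<in> cells p n" for i k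
  proof (cases "k = 0")
    case False
    then have "integrable (distr P borel (\<lambda>E. E i)) (\<lambda>w. w ^ k)"
      using noise_dist_moments(1)[OF dist[OF that] \<alpha>(1) K, of k] by simp
    then show ?thesis using that by (subst (asm) integrable_distr_eq) auto
  qed simp
  have intabs: "integrable P (\<lambda>E. \<bar>E i\<bar> ^ k)" if "i \<in> cells p n" for i k
    using integrable_abs[OF int[OF that, of k]] by (simp add: power_abs)
  have mom: "expectation (\<lambda>E. \<bar>E i\<bar> ^ k) \<le> B k" if "i \<in> cells p n" "k \<ge> 1" for i k
    using noise_dist_moments(2)[OF dist[OF that(1)] \<alpha>(1) K that(2)] that(1)
    by (subst (asm) integral_distr) (auto simp: B_def)
  have mean: "expectation (\<lambda>E. E i) = 0" and var: "expectation (\<lambda>E. (E i)\<^sup>2) = 1" if "i \<in> cells p n" for i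
  proof -
    have "(\<integral>w. w \<partial>distr P borel (\<lambda>E. E i)) = 0" "(\<integral>w. w\<^sup>2 \<partial>distr P borel (\<lambda>E. E i)) = 1"
      using dist[OF that] by (auto simp: noise_dists_def)
    then show "expectation (\<lambda>E. E i) = 0" "expectation (\<lambda>E. (E i)\<^sup>2) = 1"
      using that by (simp_all add: integral_distr)
  qed
  have cells: "i \<in> cells p n" "(fst i, n + 1 - snd i) \<in> cells p n" "i \<noteq> (fst i, n + 1 - snd i)"
    if "i \<in> {1..p} \<times> {1..n div 2}" for i
    using that by (auto simp: cells_def)
  show ?thesis
  proof
    have "indep_vars (\<lambda>i. PiM {i, (fst i, n + 1 - snd i)} (\<lambda>_. borel :: real measure))
        (\<lambda>i E. restrict (\<lambda>i. E i) {i, (fst i, n + 1 - snd i)}) ({1..p} \<times> {1..n div 2})"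
      by (rule indep_vars_restrict[OF ind]) (use cells in \<open>auto simp: disjoint_family_on_def\<close>)
    then have "indep_vars (\<lambda>_. borel)
        (\<lambda>i E. (restrict (\<lambda>i. E i) {i, (fst i, n + 1 - snd i)} i
          - restrict (\<lambda>i. E i) {i, (fst i, n + 1 - snd i)} (fst i, n + 1 - snd i) :: real)) ({1..p} \<times> {1..n div 2})"
      by (rule indep_vars_compose2) (intro borel_measurable_diff measurable_component_singleton; simp)
    then show "indep_vars (\<lambda>_. borel) (\<lambda>i E. E i - E (fst i, n + 1 - snd i)) ({1..p} \<times> {1..n div 2})"
      by simp
  next
    fix i assume i: "i \<in> {1..p} \<times> {1..n div 2}"
    let ?i = "(fst i, n + 1 - snd i)"
    note c = cells[OF i]
    note [measurable] = rv[OF c(1)] rv[OF c(2)]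
    have int_bound: "integrable P (\<lambda>E. 2 ^ k * (\<bar>E i\<bar> ^ k + \<bar>E ?i\<bar> ^ k))" for k
      using intabs c by simp
    show intD: "integrable P (\<lambda>E. (E i - E ?i) ^ k)" for k
    proof (rule Bochner_Integration.integrable_bound[OF int_bound[of k]])
      show "AE E in P. norm ((E i - E ?i) ^ k) \<le> norm (2 ^ k * (\<bar>E i\<bar> ^ k + \<bar>E ?i\<bar> ^ k))"
      proof (rule AE_I2)
        fix E :: "nat \<times> nat \<Rightarrow> real"
        show "norm ((E i - E ?i) ^ k) \<le> norm (2 ^ k * (\<bar>E i\<bar> ^ k + \<bar>E ?i\<bar> ^ k))"
          using abs_diff_power_le[of "E i" "E ?i" k] by (simp add: power_abs)
      qed
      show "(\<lambda>E. (E i - E ?i) ^ k) \<in> borel_measurable P"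
        using rv[OF c(1)] rv[OF c(2)] by (intro borel_measurable_power borel_measurable_diff)
    qed
    have int1: "integrable P (\<lambda>E. E i)" "integrable P (\<lambda>E. E ?i)"
      using int[OF c(1), of 1] int[OF c(2), of 1] by simp_all
    show "expectation (\<lambda>E. E i - E ?i) = 0"
      using int1 mean c by (simp add: Bochner_Integration.integral_diff)
    \<comment> \<open>Signs turn the difference into a sum of two independent centred variables, to
      which additivity of second moments applies.\<close>
    define g :: "nat \<times> nat \<Rightarrow> real" where "g = (\<lambda>i'. if i' = i then 1 else - 1)"
    have sq: "expectation (\<lambda>E. (\<Sum>i'\<in>{i, ?i}. g i' * E i')\<^sup>2) = (\<Sum>i'\<in>{i, ?i}. expectation (\<lambda>E. (g i' * E i')\<^sup>2))"
    proof (rule indep_sum_second_moment)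
      have "indep_vars (\<lambda>_. borel) (\<lambda>i E. E i) {i, ?i}"
        by (rule indep_vars_subset[OF ind]) (use c in auto)
      then show "indep_vars (\<lambda>_. borel) (\<lambda>i' E. g i' * E i') {i, ?i}"
        by (rule indep_vars_compose2[where Y = "\<lambda>i' x. g i' * x"]) auto
    next
      fix i' assume i': "i' \<in> {i, ?i}"
      show "integrable P (\<lambda>E. (g i' * E i') ^ k)" for k
        unfolding power_mult_distrib using i' c by (intro integrable_mult_right int) auto
      show "expectation (\<lambda>E. g i' * E i') = 0"
      proof -
        have "i' \<in> cells p n" using i' c by auto
        then show ?thesis using mean[of i'] by simp
      qed
    qed simp
    have "expectation (\<lambda>E. (g i' * E i')\<^sup>2) = 1" if "i' \<in> {i, ?i}" for i'
    proof -
      have "i' \<in> cells p n" using that c by auto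
      then show ?thesis using var[of i'] by (simp add: power_mult_distrib g_def)
    qed
    then show "expectation (\<lambda>E. (E i - E ?i)\<^sup>2) = 2"
      using sq c(3) by (simp add: g_def)
    fix k :: nat assume k: "k \<ge> 1"
    have "\<bar>expectation (\<lambda>E. (E i - E ?i) ^ k)\<bar> \<le> expectation (\<lambda>E. \<bar>E i - E ?i\<bar> ^ k)"
      unfolding power_abs[symmetric] by (rule integral_abs_bound)
    also have "\<dots> \<le> expectation (\<lambda>E. 2 ^ k * (\<bar>E i\<bar> ^ k + \<bar>E ?i\<bar> ^ k))"
      using integrable_abs[OF intD[of k]] int_bound
      by (intro integral_mono abs_diff_power_le) (auto simp: power_abs)
    also have "\<dots> = 2 ^ k * (expectation (\<lambda>E. \<bar>E i\<bar> ^ k) + expectation (\<lambda>E. \<bar>E ?i\<bar> ^ k))"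
      using intabs c by simp
    also have "\<dots> \<le> 2 ^ k * (B k + B k)"
      using mom[OF c(1) k] mom[OF c(2) k] by (intro mult_left_mono add_mono) auto
    also have "\<dots> = 2 ^ k * 2 * B k" by simp
    also have "\<dots> \<le> 2 ^ k * 2 ^ k * B k"
      using self_le_power[of "2::real" k] k K \<alpha> by (intro mult_right_mono mult_left_mono) (auto simp: B_def)
    also have "\<dots> = (2 * 2 * (2 * K * (1 / \<alpha>) powr (1 / \<alpha>) * real k powr (1 / \<alpha>))) ^ k"
      by (simp only: B_def power_mult_distrib)
    also have "\<dots> = (noise_scale \<alpha> K * real k powr (1 / \<alpha>)) ^ k"
      by (intro arg_cong[where f = "\<lambda>x. x ^ k"]) (simp add: noise_scale_def)
    finally show "\<bar>expectation (\<lambda>E. (E i - E ?i) ^ k)\<bar> \<le> (noise_scale \<alpha> K * real k powr (1 / \<alpha>)) ^ k" .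
  qed (use \<alpha> K in \<open>auto simp: noise_scale_def field_simps\<close>)
qed

section \<open>The test statistics as contrasts over column sets\<close>

definition odd_half :: "nat \<Rightarrow> nat set" where
  "odd_half t = (if t = 1 then {1} else (\<lambda>i. 2 * i - 1) ` {1..t div 2})"

text \<open>As for \<open>odd_half\<close>, the value at 1 is \<open>{1}\<close>:
  \<open>A_{1,a}\<close> uses \<open>Y_1\<close> in both roles, and all statistics then share one
  form.\<close>

definition even_half :: "nat \<Rightarrow> nat set" where
  "even_half t = (if t = 1 then {1} else (\<lambda>i. 2 * i) ` {1..t div 2})"

lemma inj_on_odd: "inj_on (\<lambda>i::nat. 2 * i - 1) {1..m}"
  by (auto simp: inj_on_def)

lemma inj_on_even: "inj_on (\<lambda>i::nat. 2 * i) {1..m}"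
  by (auto simp: inj_on_def)

lemma halves_subset: "odd_half t \<subseteq> {1..t}" "even_half t \<subseteq> {1..t}"
  by (auto simp: odd_half_def even_half_def)

lemma card_halves:
  assumes "t \<noteq> 1"
  shows "card (odd_half t) = t div 2" "card (even_half t) = t div 2"
  using assms
  by (simp_all only: odd_half_def even_half_def if_False card_image[OF inj_on_odd] card_image[OF inj_on_even]
      card_atLeastAtMost)

lemma card_halves_ge:
  assumes "t \<ge> 1"
  shows "card (odd_half t) \<ge> 1" "card (even_half t) = card (odd_half t)"
  using assms by (cases "t = 1"; simp add: card_halves; simp add: odd_half_def even_half_def)+

lemma halves_nonempty:
  assumes "t \<ge> 1"
  shows "odd_half t \<noteq> {}" "even_half t \<noteq> {}"
  using card_halves_ge[OF assms] by (metis card.empty not_one_le_zero)+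

lemma halves_disjoint: "t \<noteq> 1 \<Longrightarrow> odd_half t \<inter> even_half t = {}"
  by (auto simp: odd_half_def even_half_def) presburger

lemma grid_even: "t \<in> grid n \<Longrightarrow> t \<noteq> 1 \<Longrightarrow> even t"
  by (auto simp: grid_def)

lemma A_eq_contrast:
  assumes "n \<ge> 2" "t \<in> grid n"
  shows "A p n X t a = (\<Sum>j=1..p. ((contrast n (odd_half t) j X)\<^sup>2 - 1) *
    of_bool (a \<le> \<bar>contrast n (even_half t) j X\<bar>))"
proof (cases "t = 1")
  case True
  then show ?thesis
    by (simp add: A_def Y_def contrast_def odd_half_def even_half_def)
next
  case False
  note t = grid_bounds[OF assms]
  \<comment> \<open>Grid points other than 1 are even, so \<open>t div 2\<close> loses nothing and
    the normalisation \<open>sqrt (2 * card)\<close> of a half is \<open>sqrt t\<close>.\<close>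
  have ev: "real t = 2 * real (t div 2)" using grid_even[OF assms(2) False] by auto
  have "contrast n (odd_half t) j X = Y1 n X t j" for j
  proof -
    have "(\<Sum>c\<in>odd_half t. X (j, c) - X (j, n + 1 - c)) =
        (\<Sum>i=1..t div 2. X (j, 2 * i - 1) - X (j, n + 1 - (2 * i - 1)))"
      by (simp only: odd_half_def False if_False sum.reindex[OF inj_on_odd] comp_def)
    also have "\<dots> = (\<Sum>i=1..t div 2. X (j, 2 * i - 1) - X (j, n + 2 - 2 * i))"
      by (intro sum.cong) (auto intro!: arg_cong[where f = X])
    finally show ?thesis
      unfolding contrast_def Y1_def card_halves(1)[OF False] ev[symmetric] sum_subtractf by simp
  qed
  moreover have "contrast n (even_half t) j X = Y2 n X t j" for j
  proof -
    have "(\<Sum>c\<in>even_half t. X (j, c) - X (j, n + 1 - c)) =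
        (\<Sum>i=1..t div 2. X (j, 2 * i) - X (j, n + 1 - 2 * i))"
      by (simp only: even_half_def False if_False sum.reindex[OF inj_on_even] comp_def)
    then show ?thesis
      unfolding contrast_def Y2_def card_halves(2)[OF False] ev[symmetric] sum_subtractf by simp
  qed
  ultimately show ?thesis
    using False by (simp add: A_def)
qed

text \<open>Linearity. The bound on \<open>V\<close> keeps both \<open>c\<close> and its mirror
  \<open>n + 1 - c\<close> inside \<open>cells\<close>, outside of which the restricted function
  carries no data.\<close>

lemma contrast_shift:
  assumes "V \<subseteq> {1..n div 2}" "j \<in> {1..p}"
  shows "contrast n V j (\<lambda>i\<in>cells p n. \<theta> i + E i) = contrast n V j \<theta> + contrast n V j E"
proof -
  have "(\<Sum>c\<in>V. (\<lambda>i\<in>cells p n. \<theta> i + E i) (j, c) - (\<lambda>i\<in>cells p n. \<theta> i + E i) (j, n + 1 - c)) =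
      (\<Sum>c\<in>V. (\<theta> (j, c) - \<theta> (j, n + 1 - c)) + (E (j, c) - E (j, n + 1 - c)))"
    using assms by (intro sum.cong) (force simp: cells_def)+
  then show ?thesis
    by (simp add: contrast_def sum.distrib add_divide_distrib)
qed

lemma contrast_null:
  assumes "\<theta> \<in> null_params p n" "V \<subseteq> {1..n div 2}" "j \<in> {1..p}"
  shows "contrast n V j \<theta> = 0"
proof -
  from assms(1) obtain \<mu> where \<mu>: "\<And>t j. t \<in> {1..n} \<Longrightarrow> j \<in> {1..p} \<Longrightarrow> \<theta> (j, t) = \<mu> j"
    by (auto simp: null_params_def)
  have "(\<Sum>c\<in>V. \<theta> (j, c) - \<theta> (j, n + 1 - c)) = 0"
  proof (intro sum.neutral ballI)
    fix c assume "c \<in> V"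
    then have "1 \<le> c" "c \<le> n div 2" using assms(2) by auto
    then have "c \<in> {1..n}" "n + 1 - c \<in> {1..n}" by auto
    then show "\<theta> (j, c) - \<theta> (j, n + 1 - c) = 0"
      using assms(3) by (simp only: \<mu>)
  qed
  then show ?thesis by (simp add: contrast_def)
qed

text \<open>For \<open>c <= t\<close> column \<open>c\<close> lies before the change, and its mirror
  satisfies \<open>n + 1 - c >= t0 + 1\<close>, so it lies after. Every difference carries the full
  jump, and \<open>card V / sqrt (2 card V)\<close> is the factor.\<close>

lemma contrast_alt:
  assumes \<theta>: "\<And>c. c \<in> {1..n} \<Longrightarrow> \<theta> (j, c) = (if c \<le> t0 then \<mu>1 else \<mu>2)"
    and V: "V \<subseteq> {1..t}" "V \<noteq> {}" and t: "t \<le> t0" "t0 + t \<le> n"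
  shows "contrast n V j \<theta> = sqrt (real (card V) / 2) * (\<mu>1 - \<mu>2)"
proof -
  have "(\<Sum>c\<in>V. \<theta> (j, c) - \<theta> (j, n + 1 - c)) = (\<Sum>c\<in>V. \<mu>1 - \<mu>2)"
  proof (rule sum.cong[OF refl])
    fix c assume "c \<in> V"
    then have "1 \<le> c" "c \<le> t" using V by auto
    then show "\<theta> (j, c) - \<theta> (j, n + 1 - c) = \<mu>1 - \<mu>2"
      using t by (subst (1 2) \<theta>) auto
  qed
  moreover have "card V > 0" using V by (auto simp: card_gt_0_iff dest: finite_subset)
  then have "real (card V) / sqrt (2 * real (card V)) = sqrt (real (card V) / 2)"
    by (simp add: real_sqrt_mult real_sqrt_divide real_div_sqrt field_simps)
  ultimately show ?thesis
    unfolding contrast_def by (simp only: sum_constant times_divide_eq_left[symmetric])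
qed

section \<open>Error bounds\<close>

text \<open>\<open>L = 1 + log (p / s)\<close>: the factor e keeps \<open>L >= 1\<close> even for s
  = p, as rounding \<open>L\<close> to a moment order requires.\<close>

lemma log_ratio:
  fixes s p :: nat
  assumes "s \<in> {1..p}"
  defines "L \<equiv> ln (exp 1 * real p / real s)"
  shows "L \<ge> 1" "exp (- 2 * L) \<le> (real s / real p)\<^sup>2"
proof -
  have eL: "exp L = exp 1 * (real p / real s)"
    using assms by (simp add: L_def)
  then have "exp L \<ge> exp 1 * 1"
    using assms by (simp only:, intro mult_left_mono) auto
  then show "L \<ge> 1" by simp
  have "exp (- L) = real s / (exp 1 * real p)"
    using eL by (simp add: exp_minus)
  also have "\<dots> \<le> real s / real p"
    using assms by (intro divide_left_mono) auto
  finally have "(exp (- L))\<^sup>2 \<le> (real s / real p)\<^sup>2"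
    by (intro power_mono) auto
  then show "exp (- 2 * L) \<le> (real s / real p)\<^sup>2"
    by (simp add: power2_eq_square flip: exp_add)
qed

text \<open>\<open>8 n >= 16\<close> and \<open>ln 16 = 4 ln 2 >= 2 >= exp (1/2)\<close>: the factor
  8 keeps \<open>l\<close> away from 0 for all \<open>n >= 2\<close>.\<close>

lemma iterated_log:
  fixes n :: nat
  assumes "n \<ge> 2"
  defines "l \<equiv> ln (ln (8 * real n))"
  shows "l \<ge> 1 / 2" "exp l = ln (8 * real n)"
proof -
  have "ln (8 * real n) \<ge> ln (2 ^ 4)"
    using assms by (subst ln_le_cancel_iff) auto
  also have "ln (2 ^ 4 :: real) = 4 * ln 2"
    by (subst ln_realpow) auto
  finally have *: "ln (8 * real n) \<ge> 2"
    using ln2_ge_two_thirds by linarith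
  then have "exp (1 / 2) \<le> ln (8 * real n)"
    using exp_half_le2 by linarith
  then show "l \<ge> 1 / 2"
    unfolding l_def using * by (subst ln_ge_iff) auto
  show "exp l = ln (8 * real n)"
    using * by (simp add: l_def)
qed

definition grid_exponent :: "nat \<Rightarrow> nat" where
  "grid_exponent n = nat \<lfloor>log 2 (real n / 2)\<rfloor>"

lemma grid_eq:
  assumes "n \<ge> 2"
  shows "grid n = (\<lambda>k. 2 ^ k) ` {..grid_exponent n}"
proof -
  have "log 2 (real n / 2) \<ge> 0" using assms by simp
  then show ?thesis
    by (auto simp: grid_def grid_exponent_def le_nat_iff)
qed

text \<open>There are at most \<open>2 ln (8 n) = 2 exp l\<close> grid points above 1, so a union
  bound over events of probability \<open>exp (- l)\<close> costs a factor 2 only.\<close>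

lemma grid_exponent_le:
  assumes "n \<ge> 2"
  shows "real (grid_exponent n) * exp (- ln (ln (8 * real n))) \<le> 2"
proof -
  have "log 2 (real n / 2) \<ge> 0" using assms by simp
  then have "real (grid_exponent n) \<le> log 2 (real n / 2)"
    by (simp add: grid_exponent_def)
  also have "\<dots> = ln (real n / 2) / ln 2"
    by (simp add: log_def)
  also have "\<dots> \<le> ln (8 * real n) / (1 / 2)"
    using assms ln2_ge_two_thirds by (intro frac_le) auto
  finally have "real (grid_exponent n) \<le> 2 * exp (ln (ln (8 * real n)))"
    unfolding iterated_log(2)[OF assms] by simp
  then show ?thesis
    by (simp add: exp_minus field_simps)
qed

lemma in_grid_if_double_le:
  assumes "2 * 2 ^ k \<le> n"
  shows "2 ^ k \<in> grid n"
proof -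
  have "real (2 * 2 ^ k) \<le> real n" using assms by (simp only: of_nat_le_iff)
  then have "2 powr real k \<le> real n / 2" by (simp add: powr_realpow)
  moreover have "n > 0" using assms by (cases n) auto
  ultimately have "real k \<le> log 2 (real n / 2)" by (subst le_log_iff) auto
  then show ?thesis by (auto simp: grid_def le_floor_iff)
qed

text \<open>From \<open>24 l <= 2^(48 l)\<close>: a threshold for k that is linear in l already
  makes \<open>2 ^ k\<close> exceed a power of l. The passage from 24 to 12 leaves a factor
  \<open>2^d >= 2\<close>, which pays for \<open>2 ^ k / 2\<close>, the size of a half.\<close>

lemma grid_large:
  fixes l d :: real
  assumes "l > 0" "d \<ge> 1" "real k > 48 * d * l"
  shows "(12 * l) powr d \<le> 2 ^ k / 2"
proof -
  have "24 * l \<le> 48 * l * ln 2"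
    using assms(1) ln2_ge_two_thirds by simp
  also have "\<dots> \<le> exp (48 * l * ln 2)"
    using exp_ge_add_one_self[of "48 * l * ln 2"] by linarith
  also have "\<dots> = 2 powr (48 * l)"
    by (simp add: powr_def)
  finally have "(24 * l) powr d \<le> (2 powr (48 * l)) powr d"
    using assms by (intro powr_mono2) auto
  also have "\<dots> = 2 powr (48 * d * l)"
    by (simp add: powr_powr mult_ac)
  also have "\<dots> \<le> 2 powr real k"
    using assms by (intro powr_mono) auto
  also have "\<dots> = 2 ^ k" by (simp add: powr_realpow)
  finally have "(24 * l) powr d \<le> 2 ^ k" .
  moreover have "2 powr 1 * (12 * l) powr d \<le> 2 powr d * (12 * l) powr d"
    using assms by (intro mult_right_mono powr_mono) auto
  moreover have "2 powr d * (12 * l) powr d = (24 * l) powr d"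
    by (simp flip: powr_mult)
  ultimately show ?thesis by simp
qed

section \<open>Reduction of the test to events of the noise\<close>

definition shifted :: "nat \<Rightarrow> nat \<Rightarrow> (nat \<times> nat \<Rightarrow> real) \<Rightarrow> (nat \<times> nat \<Rightarrow> real) \<Rightarrow> nat \<times> nat \<Rightarrow> real" where
  "shifted p n \<theta> E = (\<lambda>i\<in>cells p n. \<theta> i + E i)"

lemma shifted_measurable:
  assumes "sets P = sets (matrix_space p n)"
  shows "shifted p n \<theta> \<in> measurable P (matrix_space p n)"
  unfolding shifted_def measurable_cong_sets[OF assms refl]
  by (intro measurable_restrict borel_measurable_add borel_measurable_const measurable_component_singleton)

lemma nn_integral_data_law:
  assumes "sets P = sets (matrix_space p n)" "f \<in> borel_measurable (matrix_space p n)"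
  shows "(\<integral>\<^sup>+X. f X \<partial>data_law p n \<theta> P) = (\<integral>\<^sup>+E. f (shifted p n \<theta> E) \<partial>P)"
  using shifted_measurable[OF assms(1)] assms(2)
  unfolding data_law_def shifted_def by (intro nn_integral_distr) auto

lemma grid_max_gr_iff:
  "grid n - {1} \<noteq> {} \<and> Max ((\<lambda>t. A p n X t a) ` (grid n - {1})) > r
    \<longleftrightarrow> (\<exists>t\<in>grid n - {1}. r < A p n X t a)"
  using finite_grid[of n] by (cases "grid n - {1} = {}") (auto simp: Max_gr_iff)

lemma sparse_test_le:
  "sparse_test p n a r r1 X \<le> (\<Sum>t\<in>grid n - {1}. of_bool (r < A p n X t a)) + of_bool (r1 < A p n X 1 a)"
proof -
  have "(of_bool (\<exists>t\<in>grid n - {1}. r < A p n X t a) :: real)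
      \<le> (\<Sum>t\<in>grid n - {1}. of_bool (r < A p n X t a))"
  proof (cases "\<exists>t\<in>grid n - {1}. r < A p n X t a")
    case True
    then obtain t where t: "t \<in> grid n - {1}" "r < A p n X t a" by blast
    then have "(\<Sum>t\<in>{t}. of_bool (r < A p n X t a)) \<le> (\<Sum>t\<in>grid n - {1}. of_bool (r < A p n X t a) :: real)"
      using finite_grid[of n] by (intro sum_mono2) auto
    then show ?thesis using True t(2) by (simp only: of_bool_def if_True) simp
  next
    case False
    then show ?thesis by (simp only: of_bool_def if_False) (simp add: sum_nonneg)
  qed
  moreover have "0 \<le> (\<Sum>t\<in>grid n - {1}. of_bool (r < A p n X t a) :: real)"
    by (simp add: sum_nonneg)
  moreover have "0 \<le> (of_bool (r1 < A p n X 1 a) :: real)"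
    by simp
  ultimately show ?thesis
    unfolding sparse_test_def grid_max_gr_iff by (intro max.boundedI) linarith+
qed

text \<open>Acceptance bounds every statistic by its threshold, so under the alternative one well
  chosen t is enough.\<close>

lemma sparse_test_accept:
  assumes "t \<in> grid n"
  shows "1 - sparse_test p n a r r1 X \<le> of_bool (A p n X t a \<le> (if t = 1 then r1 else r))"
proof (cases "A p n X t a \<le> (if t = 1 then r1 else r)")
  case True
  have "0 \<le> sparse_test p n a r r1 X"
    by (simp add: sparse_test_def le_max_iff_disj)
  then show ?thesis using True by simp
next
  case False
  have "sparse_test p n a r r1 X = 1"
  proof (cases "t = 1")
    case t: True
    then have "r1 < A p n X 1 a" using False by simp
    then show ?thesis by (simp add: sparse_test_def max_def of_bool_def)
  next
    case t: False
    then have "\<exists>t\<in>grid n - {1}. r < A p n X t a"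
      using False assms t by (intro bexI[of _ t]) auto
    then show ?thesis unfolding sparse_test_def grid_max_gr_iff by (simp only: of_bool_def if_True) simp
  qed
  then show ?thesis by simp
qed

section \<open>Both errors under one fixed noise law\<close>

locale noise_model =
  fixes \<alpha> K :: real and p n s :: nat and P :: "(nat \<times> nat \<Rightarrow> real) measure" and a c :: real
  assumes \<alpha>: "0 < \<alpha>" "\<alpha> \<le> 2" and K: "K > 0" and n: "n \<ge> 2" and s: "s \<in> {1..p}"
    and P: "P \<in> noise_laws \<alpha> K p n"
    and c: "c > 0" "c\<^sup>2 \<ge> exp 2 * 4 powr (1 / \<alpha>) * stretched_const (noise_scale \<alpha> K) (1 / \<alpha>)"
    and a: "a \<ge> c * ln (exp 1 * real p / real s) powr (1 / \<alpha>)"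
begin

sublocale noise_array P "\<lambda>i E. E i - E (fst i, n + 1 - snd i)" "{1..p}" "{1..n div 2}"
    "noise_scale \<alpha> K" "1 / \<alpha>"
  using noise_array_differences[OF P \<alpha> K] .

definition l :: real where
  "l = ln (ln (8 * real n))"

lemma a_nonneg: "a \<ge> 0"
proof -
  have "0 \<le> c * ln (exp 1 * real p / real s) powr (1 / \<alpha>)" using c(1) by simp
  then show ?thesis using a by linarith
qed

lemma sets_P: "sets P = sets (matrix_space p n)"
  using P by (simp add: noise_laws_def)

lemma N_eq_contrast: "N V j E = contrast n V j E"
  unfolding N_def contrast_def by simp

lemma tail:
  assumes "V \<subseteq> {1..n div 2}" "V \<noteq> {}" "j \<in> {1..p}"
  shows "prob {w \<in> space P. a \<le> \<bar>N V j w\<bar>} \<le> (real s / real (card {1..p}))\<^sup>2"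
  using N_tail_exp[OF assms log_ratio(1)[OF s] a c] log_ratio(2)[OF s] by simp

lemma halves:
  assumes "t \<in> grid n"
  shows "odd_half t \<subseteq> {1..n div 2}" "odd_half t \<noteq> {}" "even_half t \<subseteq> {1..n div 2}" "even_half t \<noteq> {}"
proof -
  note t = grid_bounds[OF n assms]
  then have "{1..t} \<subseteq> {1..n div 2}" by auto
  then show "odd_half t \<subseteq> {1..n div 2}" "even_half t \<subseteq> {1..n div 2}"
    using halves_subset[of t] by auto
  show "odd_half t \<noteq> {}" "even_half t \<noteq> {}" using halves_nonempty[OF t(1)] .
qed

lemma A_shifted:
  assumes "t \<in> grid n"
  shows "A p n (shifted p n \<theta> E) t a = (\<Sum>j=1..p.
    ((contrast n (odd_half t) j \<theta> + N (odd_half t) j E)\<^sup>2 - 1) *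
      of_bool (a \<le> \<bar>contrast n (even_half t) j \<theta> + N (even_half t) j E\<bar>))"
  unfolding A_eq_contrast[OF n assms] shifted_def N_eq_contrast
  using halves[OF assms] by (intro sum.cong refl) (simp add: contrast_shift)

lemma A_shifteded_measurable:
  assumes "t \<in> grid n"
  shows "(\<lambda>E. A p n (shifted p n \<theta> E) t a) \<in> borel_measurable P"
  using measurable_compose[OF shifted_measurable[OF sets_P] A_measurable[OF n assms]] .

lemma A_null:
  assumes "t \<in> grid n" "\<theta> \<in> null_params p n"
  shows "A p n (shifted p n \<theta> E) t a = (\<Sum>j\<in>{1..p}. excess (odd_half t) (even_half t) a j E)"
  unfolding A_shifted[OF assms(1)] excess_def
  using halves[OF assms(1)] contrast_null[OF assms(2)] by (intro sum.cong refl) simp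

text \<open>The three summands belong to three groups of scales: at most \<open>48 d l\<close> small
  ones at Chebyshev's price \<open>(fc + 1) / (c2^2 l)\<close>, so that l cancels; the large ones,
  with total at most \<open>2 \<eta>\<close>; and t = 1 by Markov.\<close>

lemma null_error:
  assumes \<theta>: "\<theta> \<in> null_params p n" and c2: "c2 > 0" "12 * deviation_const (noise_scale \<alpha> K) (1 / \<alpha>) / c2 \<le> exp (- 3)"
    and r: "r \<ge> c2 * (sqrt (real s * l) + l)" and r1: "r1 > 0"
  shows "(\<integral>\<^sup>+X. ennreal (sparse_test p n a r r1 X) \<partial>data_law p n \<theta> P) \<le> ennreal (
    48 * (6 / \<alpha> + 3) * (fourth_const (noise_scale \<alpha> K) (1 / \<alpha>) + 1) / c2\<^sup>2 +
    2 * (12 * deviation_const (noise_scale \<alpha> K) (1 / \<alpha>) / c2) +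
    (fourth_const (noise_scale \<alpha> K) (1 / \<alpha>) + 2) / 2 * real s / r1)"
proof -
  define fc where "fc = fourth_const (noise_scale \<alpha> K) (1 / \<alpha>)"
  define \<eta> where "\<eta> = 12 * deviation_const (noise_scale \<alpha> K) (1 / \<alpha>) / c2"
  \<comment> \<open>The exponent \<open>6 \<kappa> + 3\<close> that the Gaussian moment bound
    demands of the sample size.\<close>
  define d where "d = 6 / \<alpha> + 3"
  define x where "x = (fc + 1) / (c2\<^sup>2 * l)"
  have fc: "fc > 0" and \<eta>: "\<eta> > 0" using consts_pos c2 by (simp_all add: fc_def \<eta>_def)
  have d: "d \<ge> 1" using \<alpha> by (simp add: d_def)
  have l: "l \<ge> 1 / 2" unfolding l_def by (rule iterated_log(1)[OF n])
  have exponent: "real (grid_exponent n) * exp (- l) \<le> 2" unfolding l_def by (rule grid_exponent_le[OF n])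
  have x: "x \<ge> 0" using fc l by (simp add: x_def)
  have s1: "1 \<le> s" "s \<le> card {1..p}" "real s > 0" using s by auto
  have rpos: "r > 0"
  proof -
    have "0 < c2 * (sqrt (real s * l) + l)"
      using c2 l by (intro mult_pos_pos add_nonneg_pos) auto
    then show ?thesis using r by linarith
  qed
  let ?A = "\<lambda>t E. A p n (shifted p n \<theta> E) t a"
  have one: "1 \<in> grid n" using in_grid_if_double_le[of 0 n] n by simp
  have first: "prob {E \<in> space P. r1 < ?A 1 E} \<le> (fc + 2) / 2 * real s / r1"
    unfolding A_null[OF one \<theta>] fc_def
    by (rule null_rejection_markov[OF halves[OF one] s1(1,2) tail[OF halves(3,4)[OF one]] r1])
  have other: "prob {E \<in> space P. r < ?A (2 ^ k) E} \<le> x * of_bool (real k \<le> 48 * d * l) + \<eta> * exp (- l)"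
    if k: "k \<in> {1..grid_exponent n}" for k
  proof -
    have t: "2 ^ k \<in> grid n" "2 ^ k \<noteq> (1::nat)" using k by (auto simp: grid_eq[OF n])
    note V = halves[OF t(1)] s1(1,2) tail[OF halves(3,4)[OF t(1)]]
    show ?thesis
    proof (cases "real k \<le> 48 * d * l")
      case True
      have "prob {E \<in> space P. r < ?A (2 ^ k) E} \<le> (fc + 1) * real s / r\<^sup>2"
        unfolding A_null[OF t(1) \<theta>] fc_def
        by (rule null_rejection_chebyshev[OF V rpos halves_disjoint[OF t(2)]])
      \<comment> \<open>The part \<open>c2 * sqrt (s * l)\<close> of r is measured against a
        standard deviation of order \<open>sqrt s\<close>, so s cancels.\<close>
      also have "\<dots> \<le> (fc + 1) * real s / (c2\<^sup>2 * (real s * l))"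
      proof (rule divide_left_mono)
        have "c2 * sqrt (real s * l) \<le> c2 * (sqrt (real s * l) + l)"
          using c2 l by (intro mult_left_mono) auto
        then have "c2 * sqrt (real s * l) \<le> r"
          using r by linarith
        then have "(c2 * sqrt (real s * l))\<^sup>2 \<le> r\<^sup>2"
          using c2 l by (intro power_mono) auto
        then show "c2\<^sup>2 * (real s * l) \<le> r\<^sup>2"
          using l by (simp add: power_mult_distrib)
      qed (use fc c2 l s1 rpos in auto)
      also have "\<dots> = x" using s1 by (simp add: x_def)
      finally show ?thesis
        using True \<eta> by (simp add: add_increasing2)
    next
      case False
      have "even (2 ^ k :: nat)" using k by auto
      then have "real (card (odd_half (2 ^ k))) = 2 ^ k / 2"
        unfolding card_halves(1)[OF t(2)] by (simp add: real_of_nat_div)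
      then have "(12 * l) powr (6 * (1 / \<alpha>) + 3) \<le> real (card (odd_half (2 ^ k)))"
        using grid_large[of l d k] False d l by (simp add: d_def)
      then have "prob {E \<in> space P. r < ?A (2 ^ k) E} \<le> \<eta> * exp (- l)"
        unfolding A_null[OF t(1) \<theta>] \<eta>_def
        by (intro null_rejection_exponential[OF V halves_disjoint[OF t(2)] l c2(1) r _ c2(2)])
      then show ?thesis using False by simp
    qed
  qed
  have meas: "{E \<in> space P. y < ?A t E} \<in> sets P" if "t \<in> grid n" for t y
    using A_shifteded_measurable[OF that, of \<theta>] by measurable
  have grid1: "grid n - {1} = (\<lambda>k. 2 ^ k) ` {1..grid_exponent n}"
  proof -
    have "(2::nat) ^ k = 1 \<longleftrightarrow> k = 0" for k by simp
    then show ?thesis unfolding grid_eq[OF n] by (auto simp: image_iff Suc_le_eq)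
  qed
  have "(\<Sum>t\<in>grid n - {1}. prob {E \<in> space P. r < ?A t E}) =
      (\<Sum>k=1..grid_exponent n. prob {E \<in> space P. r < ?A (2 ^ k) E})"
    unfolding grid1 by (subst sum.reindex) (auto simp: inj_on_def)
  also have "\<dots> \<le> (\<Sum>k=1..grid_exponent n. x * of_bool (real k \<le> 48 * d * l) + \<eta> * exp (- l))"
    using other by (rule sum_mono)
  also have "\<dots> = x * (\<Sum>k=1..grid_exponent n. of_bool (real k \<le> 48 * d * l)) + \<eta> * (real (grid_exponent n) * exp (- l))"
    by (simp add: sum.distrib sum_distrib_left)
  also have "\<dots> \<le> x * (48 * d * l) + \<eta> * 2"
  proof (intro add_mono mult_left_mono exponent)
    have nn: "48 * d * l \<ge> 0" using d l by simp
    have "(\<Sum>k=1..grid_exponent n. of_bool (real k \<le> 48 * d * l)) =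
        real (card {k \<in> {1..grid_exponent n}. real k \<le> 48 * d * l})"
      by (simp add: of_bool_def sum.If_cases Int_def)
    also have "\<dots> \<le> real (card {1..nat \<lfloor>48 * d * l\<rfloor>})"
    proof -
      have "{k \<in> {1..grid_exponent n}. real k \<le> 48 * d * l} \<subseteq> {1..nat \<lfloor>48 * d * l\<rfloor>}"
        by (auto simp: le_nat_floor)
      then show ?thesis by (intro of_nat_mono card_mono) auto
    qed
    also have "\<dots> \<le> 48 * d * l" using nn by simp
    finally show "(\<Sum>k=1..grid_exponent n. of_bool (real k \<le> 48 * d * l)) \<le> 48 * d * l" .
  qed (use x \<eta> in auto)
  also have "x * (48 * d * l) = 48 * d * (fc + 1) / c2\<^sup>2"
    using l by (simp add: x_def)
  finally have sum: "(\<Sum>t\<in>grid n - {1}. prob {E \<in> space P. r < ?A t E}) \<le> 48 * d * (fc + 1) / c2\<^sup>2 + 2 * \<eta>"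
    by (simp add: mult.commute)
  have "(\<integral>\<^sup>+X. ennreal (sparse_test p n a r r1 X) \<partial>data_law p n \<theta> P)
      = (\<integral>\<^sup>+E. ennreal (sparse_test p n a r r1 (shifted p n \<theta> E)) \<partial>P)"
    using sparse_test_measurable[OF n] by (intro nn_integral_data_law sets_P) measurable
  also have "\<dots> \<le> (\<integral>\<^sup>+E. (\<Sum>t\<in>grid n - {1}. indicator {E \<in> space P. r < ?A t E} E)
      + indicator {E \<in> space P. r1 < ?A 1 E} E \<partial>P)"
  proof (rule nn_integral_mono)
    fix E assume E: "E \<in> space P"
    have "ennreal (sparse_test p n a r r1 (shifted p n \<theta> E)) \<le>
        ennreal ((\<Sum>t\<in>grid n - {1}. of_bool (r < ?A t E)) + of_bool (r1 < ?A 1 E))"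
      by (intro ennreal_leI sparse_test_le)
    also have "\<dots> = (\<Sum>t\<in>grid n - {1}. ennreal (of_bool (r < ?A t E))) + ennreal (of_bool (r1 < ?A 1 E))"
      by (simp add: sum_nonneg flip: sum_ennreal)
    also have "\<dots> = (\<Sum>t\<in>grid n - {1}. indicator {E \<in> space P. r < ?A t E} E)
        + indicator {E \<in> space P. r1 < ?A 1 E} E"
      using E by (intro arg_cong2[where f = "(+)"] sum.cong) (auto simp: indicator_def)
    finally show "ennreal (sparse_test p n a r r1 (shifted p n \<theta> E)) \<le>
        (\<Sum>t\<in>grid n - {1}. indicator {E \<in> space P. r < ?A t E} E) + indicator {E \<in> space P. r1 < ?A 1 E} E" .
  qed
  also have "\<dots> = (\<Sum>t\<in>grid n - {1}. emeasure P {E \<in> space P. r < ?A t E}) + emeasure P {E \<in> space P. r1 < ?A 1 E}"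
  proof -
    have ind: "indicator {E \<in> space P. y < ?A t E} \<in> borel_measurable P" if "t \<in> grid n" for t y
      using meas[OF that] by (rule borel_measurable_indicator)
    have "(\<integral>\<^sup>+E. (\<Sum>t\<in>grid n - {1}. indicator {E \<in> space P. r < ?A t E} E) \<partial>P) =
        (\<Sum>t\<in>grid n - {1}. emeasure P {E \<in> space P. r < ?A t E})"
      using ind meas by (subst nn_integral_sum) (auto intro!: sum.cong nn_integral_indicator)
    then show ?thesis
      using ind meas one by (subst nn_integral_add) (auto intro!: borel_measurable_sum nn_integral_indicator)
  qed
  also have "\<dots> = ennreal ((\<Sum>t\<in>grid n - {1}. prob {E \<in> space P. r < ?A t E}) + prob {E \<in> space P. r1 < ?A 1 E})"
    by (simp add: emeasure_eq_measure sum_nonneg sum_ennreal)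
  also have "\<dots> \<le> ennreal (48 * d * (fc + 1) / c2\<^sup>2 + 2 * \<eta> + (fc + 2) / 2 * real s / r1)"
    using sum first by (intro ennreal_leI) linarith
  finally show ?thesis by (simp only: d_def fc_def \<eta>_def)
qed

text \<open>Three factors 2 are lost between \<open>\<rho>^2\<close> and the captured energy
  \<open>Q\<close>: from the shorter segment to the dyadic t, from t to the size v of a half, and in
  the squared factor \<open>v / 2\<close> of a contrast. Hence
  \<open>\<rho>^2 <= 8 Q\<close>.\<close>

lemma alt_error:
  assumes \<theta>: "\<theta> \<in> alt_params p n s \<rho>" and \<rho>: "\<rho>\<^sup>2 > 0"
    and small: "real s * (2 * a\<^sup>2 + 1) + r \<le> \<rho>\<^sup>2 / 32" "real s * (2 * a\<^sup>2 + 1) + r1 \<le> \<rho>\<^sup>2 / 32"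
  shows "(\<integral>\<^sup>+X. ennreal (1 - sparse_test p n a r r1 X) \<partial>data_law p n \<theta> P) \<le>
    ennreal (4 * ((fourth_const (noise_scale \<alpha> K) (1 / \<alpha>) + 8) / 2 * real s) / (\<rho>\<^sup>2 / 8))"
proof -
  from \<theta> obtain t0 \<mu>1 \<mu>2 where t0: "1 \<le> t0" "t0 < n"
    and \<theta>_eq: "\<And>t j. t \<in> {1..n} \<Longrightarrow> j \<in> {1..p} \<Longrightarrow> \<theta> (j, t) = (if t \<le> t0 then \<mu>1 j else \<mu>2 j)"
    and l0: "l0_norm p (\<lambda>j. \<mu>1 j - \<mu>2 j) \<le> s"
    and sep: "real t0 * (real n - real t0) / real n * (L2_set (\<lambda>j. \<mu>1 j - \<mu>2 j) {1..p})\<^sup>2 \<ge> \<rho>\<^sup>2"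
    unfolding alt_params_def alt_params_at_def by fastforce
  define \<Delta> where "\<Delta> j = \<mu>1 j - \<mu>2 j" for j
  define D2 where "D2 = (\<Sum>j=1..p. (\<Delta> j)\<^sup>2)"
  have D2: "D2 \<ge> 0" by (simp add: D2_def sum_nonneg)
  \<comment> \<open>The shorter segment limits how many columns on each side are free of the change,
    and \<open>t0 (n - t0) / n <= m\<close> because the longer segment is at most n.\<close>
  define m where "m = min t0 (n - t0)"
  have "m \<ge> 1" using t0 by (simp add: m_def)
  then obtain k where k: "2 ^ k \<le> m" "m < 2 ^ (k + 1)"
    using ex_power_ivl1[of 2 m] by auto
  define t :: nat where "t = 2 ^ k"
  have t: "t \<ge> 1" "t \<le> t0" "t0 + t \<le> n" "m < 2 * t"
    using k t0 by (auto simp: t_def m_def)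
  have tg: "t \<in> grid n"
    using in_grid_if_double_le[of k n] t by (simp add: t_def)
  define v where "v = card (odd_half t)"
  have cv: "card (even_half t) = v" "v \<ge> 1" using card_halves_ge[OF t(1)] by (simp_all add: v_def)
  have v: "real v \<ge> real t / 2"
  proof (cases "t = 1")
    case False
    then show ?thesis using grid_even[OF tg] by (auto simp: v_def card_halves)
  qed (use cv in auto)
  define \<delta> where "\<delta> j = sqrt (real v / 2) * \<Delta> j" for j
  have \<delta>: "contrast n (odd_half t) j \<theta> = \<delta> j" "contrast n (even_half t) j \<theta> = \<delta> j" if "j \<in> {1..p}" for j
    using contrast_alt[of n \<theta> j t0 "\<mu>1 j" "\<mu>2 j", OF \<theta>_eq[OF _ that] halves_subset(1) halves(2)[OF tg] t(2,3)]
      contrast_alt[of n \<theta> j t0 "\<mu>1 j" "\<mu>2 j", OF \<theta>_eq[OF _ that] halves_subset(2) halves(4)[OF tg] t(2,3)]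
    by (simp_all add: \<delta>_def \<Delta>_def cv v_def)
  define S where "S = {j \<in> {1..p}. \<Delta> j \<noteq> 0}"
  have S: "S \<subseteq> {1..p}" "card S \<le> s" "\<And>j. j \<in> {1..p} - S \<Longrightarrow> \<delta> j = 0"
    using l0 by (auto simp: S_def l0_norm_def \<Delta>_def \<delta>_def)
  define Q where "Q = (\<Sum>j\<in>S. (\<delta> j)\<^sup>2)"
  have "(\<Sum>j\<in>S. (\<delta> j)\<^sup>2) = (\<Sum>j=1..p. (\<delta> j)\<^sup>2)"
    using S by (intro sum.mono_neutral_left) auto
  then have Q_eq: "Q = real v / 2 * D2"
    by (simp add: Q_def \<delta>_def D2_def power_mult_distrib sum_distrib_left)
  have Q: "\<rho>\<^sup>2 / 8 \<le> Q"
  proof -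
    have "t0 * (n - t0) \<le> m * n"
      using t0 unfolding m_def min_def by (auto intro: mult_le_mono)
    then have "real (t0 * (n - t0)) \<le> real (m * n)" by (simp only: of_nat_le_iff)
    then have "real t0 * (real n - real t0) / real n \<le> real m"
      using t0 by (simp add: of_nat_diff divide_le_eq)
    also have "\<dots> \<le> 2 * real t" using t(4) by linarith
    finally have "real t0 * (real n - real t0) / real n * D2 \<le> 2 * real t * D2"
      using D2 by (rule mult_right_mono)
    moreover have "(L2_set (\<lambda>j. \<mu>1 j - \<mu>2 j) {1..p})\<^sup>2 = D2"
      by (simp add: L2_set_def D2_def \<Delta>_def sum_nonneg)
    ultimately have "\<rho>\<^sup>2 \<le> 2 * real t * D2" using sep by simp
    also have "\<dots> \<le> 4 * real v * D2"
      using v D2 by (intro mult_right_mono) auto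
    finally show ?thesis by (simp add: Q_eq)
  qed
  have Qpos: "Q > 0" using Q \<rho> by linarith
  let ?r = "if t = 1 then r1 else r"
  let ?B = "{E \<in> space P. A p n (shifted p n \<theta> E) t a \<le> ?r}"
  have A_eq: "A p n (shifted p n \<theta> E) t a = (\<Sum>j\<in>{1..p}. ((\<delta> j + N (odd_half t) j E)\<^sup>2 - 1) *
      of_bool (a \<le> \<bar>\<delta> j + N (even_half t) j E\<bar>))" for E
    unfolding A_shifted[OF tg] using \<delta> by (intro sum.cong) auto
  have s1: "1 \<le> s" "s \<le> card {1..p}" using s by auto
  have "real s * (2 * a\<^sup>2 + 1) + ?r \<le> Q / 4"
    using small Q by auto
  then have "prob ?B \<le> 4 * ((fourth_const (noise_scale \<alpha> K) (1 / \<alpha>) + 8) / 2 * real s) / Q"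
    unfolding A_eq Q_def
    by (intro alternative_acceptance[OF halves[OF tg] s1 tail[OF halves(3,4)[OF tg]] S Qpos[unfolded Q_def] _ a_nonneg])
      (simp only: Q_def)
  also have "\<dots> \<le> 4 * ((fourth_const (noise_scale \<alpha> K) (1 / \<alpha>) + 8) / 2 * real s) / (\<rho>\<^sup>2 / 8)"
    using Q \<rho> Qpos consts_pos by (intro divide_left_mono) auto
  finally have prob: "prob ?B \<le> 4 * ((fourth_const (noise_scale \<alpha> K) (1 / \<alpha>) + 8) / 2 * real s) / (\<rho>\<^sup>2 / 8)" .
  have meas: "?B \<in> sets P"
    using A_shifteded_measurable[OF tg, of \<theta>] by measurable
  have "(\<integral>\<^sup>+X. ennreal (1 - sparse_test p n a r r1 X) \<partial>data_law p n \<theta> P)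
      = (\<integral>\<^sup>+E. ennreal (1 - sparse_test p n a r r1 (shifted p n \<theta> E)) \<partial>P)"
    using sparse_test_measurable[OF n] by (intro nn_integral_data_law sets_P) measurable
  also have "\<dots> \<le> (\<integral>\<^sup>+E. indicator ?B E \<partial>P)"
  proof (rule nn_integral_mono)
    fix E assume E: "E \<in> space P"
    have "ennreal (1 - sparse_test p n a r r1 (shifted p n \<theta> E)) \<le>
        ennreal (of_bool (A p n (shifted p n \<theta> E) t a \<le> ?r))"
      by (intro ennreal_leI sparse_test_accept tg)
    also have "\<dots> = indicator ?B E"
      using E by (simp add: of_bool_def indicator_def)
    finally show "ennreal (1 - sparse_test p n a r r1 (shifted p n \<theta> E)) \<le> indicator ?B E" .
  qed
  also have "\<dots> = emeasure P ?B"
    using meas by (rule nn_integral_indicator)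
  also have "\<dots> = ennreal (prob ?B)"
    by (rule emeasure_eq_measure)
  also have "\<dots> \<le> ennreal (4 * ((fourth_const (noise_scale \<alpha> K) (1 / \<alpha>) + 8) / 2 * real s) / (\<rho>\<^sup>2 / 8))"
    using prob by (rule ennreal_leI)
  finally show ?thesis .
qed

end

section \<open>Comparison of the thresholds with the separation, and choice of the constants\<close>

lemma threshold_bounds:
  fixes L l \<kappa> c1 c2 c3 :: real and s :: nat
  assumes "L \<ge> 1" "l \<ge> 0" "s \<ge> 1" "\<kappa> \<ge> 0" "c1 > 0" "c2 > 0" "c3 > 0"
  defines "B \<equiv> real s * L powr (2 * \<kappa>) + l"
    and "a \<equiv> c1 * (L powr \<kappa> + real s powr (- 1 / 2) * l powr (1 / 2))"
  shows "real s * (2 * a\<^sup>2 + 1) + c2 * (sqrt (real s * l) + l) \<le> (4 * c1\<^sup>2 + 1 + 2 * c2 + c3) * B"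
    and "real s * (2 * a\<^sup>2 + 1) + c3 * real s * L powr (2 * \<kappa>) \<le> (4 * c1\<^sup>2 + 1 + 2 * c2 + c3) * B"
    and "real s \<le> B"
proof -
  have L: "L powr (2 * \<kappa>) \<ge> 1" using assms by (intro ge_one_powr_ge_zero) auto
  then have "real s * 1 \<le> real s * L powr (2 * \<kappa>)"
    by (intro mult_left_mono) auto
  then show sB: "real s \<le> B" using assms(2) by (simp add: B_def)
  have lB: "l \<le> B" by (simp add: B_def)
  have B0: "B \<ge> 0" using sB by linarith
  have "real s * l \<le> B * B"
    using sB lB assms(2) B0 by (intro mult_mono) auto
  then have sq: "sqrt (real s * l) \<le> B"
    using B0 by (intro real_le_lsqrt) (auto simp: power2_eq_square)
  \<comment> \<open>After squaring, the two parts of \<open>a\<close> contribute to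
    \<open>s a^2\<close> multiples of \<open>s L^(2 \<kappa>)\<close> and of l, which are the two
    parts of \<open>B\<close>.\<close>
  have a: "real s * a\<^sup>2 \<le> 2 * c1\<^sup>2 * B"
  proof -
    have "(L powr \<kappa>)\<^sup>2 = L powr (2 * \<kappa>)"
      by (simp add: power2_eq_square flip: powr_add)
    moreover have "(real s powr (- 1 / 2) * l powr (1 / 2))\<^sup>2 = l / real s"
      using assms by (simp add: power_mult_distrib powr_half_sqrt powr_minus_divide power_divide)
    moreover have "(u + v)\<^sup>2 \<le> 2 * (u\<^sup>2 + v\<^sup>2)" for u v :: real
      using zero_le_power2[of "u - v"] by (simp add: power2_eq_square algebra_simps)
    ultimately have "(L powr \<kappa> + real s powr (- 1 / 2) * l powr (1 / 2))\<^sup>2 \<le> 2 * (L powr (2 * \<kappa>) + l / real s)"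
      by metis
    then have "real s * c1\<^sup>2 * (L powr \<kappa> + real s powr (- 1 / 2) * l powr (1 / 2))\<^sup>2
        \<le> real s * c1\<^sup>2 * (2 * (L powr (2 * \<kappa>) + l / real s))"
      by (intro mult_left_mono) auto
    also have "\<dots> = 2 * c1\<^sup>2 * B"
      using assms(3) by (simp add: B_def field_simps)
    finally show ?thesis
      by (simp add: a_def power_mult_distrib mult_ac)
  qed
  have 1: "real s * (2 * a\<^sup>2 + 1) \<le> (4 * c1\<^sup>2 + 1) * B"
    using a sB by (simp add: algebra_simps)
  have 2: "c2 * (sqrt (real s * l) + l) \<le> c2 * (B + B)"
    using sq lB assms by (intro mult_left_mono add_mono) auto
  have 3: "c3 * real s * L powr (2 * \<kappa>) \<le> c3 * B"
    using assms by (simp add: B_def)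
  have 4: "0 \<le> c2 * B" "0 \<le> c3 * B" using B0 assms by auto
  show "real s * (2 * a\<^sup>2 + 1) + c2 * (sqrt (real s * l) + l) \<le> (4 * c1\<^sup>2 + 1 + 2 * c2 + c3) * B"
    using 1 2 4 by (simp add: algebra_simps)
  show "real s * (2 * a\<^sup>2 + 1) + c3 * real s * L powr (2 * \<kappa>) \<le> (4 * c1\<^sup>2 + 1 + 2 * c2 + c3) * B"
    using 1 3 4 by (simp add: algebra_simps)
qed

theorem theorem2:
  fixes \<alpha> K \<epsilon> :: real
  assumes "0 < \<alpha>" "\<alpha> \<le> 2" "K > 0" "0 < \<epsilon>" "\<epsilon> < 1"
  shows "\<exists>C1 C2 C3 C4 :: real. C1 > 0 \<and> C2 > 0 \<and> C3 > 0 \<and> C4 > 0 \<and>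
    (\<forall>(n::nat) (p::nat) (s::nat) (\<rho>::real). n \<ge> 2 \<longrightarrow> p \<ge> 1 \<longrightarrow> s \<in> {1..p} \<longrightarrow>
      (let L = ln (exp 1 * real p / real s);
           a = C1 * (L powr (1 / \<alpha>) + real s powr (- 1 / 2) * ln (ln (8 * real n)) powr (1 / 2));
           r = C2 * (sqrt (real s * ln (ln (8 * real n))) + ln (ln (8 * real n)));
           r1 = C3 * real s * L powr (2 / \<alpha>)
       in \<rho>\<^sup>2 \<ge> C4 * (real s * L powr (2 / \<alpha>) + ln (ln (8 * real n))) \<longrightarrow>
          testing_error \<alpha> K p n s \<rho> (sparse_test p n a r r1) \<le> ennreal \<epsilon>))"
proof -
  define G where "G = noise_scale \<alpha> K"
  have "G > 0" using assms by (simp add: G_def noise_scale_def)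
  define sc where "sc = stretched_const G (1 / \<alpha>)"
  define fc where "fc = fourth_const G (1 / \<alpha>)"
  define dc where "dc = deviation_const G (1 / \<alpha>)"
  have pos: "sc > 0" "fc > 0" "dc > 0"
    using const_pos[OF \<open>G > 0\<close>] by (simp_all add: sc_def fc_def dc_def)
  \<comment> \<open>Equality in the condition under which the tail is at most
    \<open>exp (- 2 L)\<close>.\<close>
  define C1 where "C1 = sqrt (exp 2 * 4 powr (1 / \<alpha>) * sc)"
  define g where "g = 48 * (6 / \<alpha> + 3) * (fc + 1)"
  \<comment> \<open>The summands secure \<open>12 dc / C2 <= exp (-3)\<close>,
    \<open>24 dc / C2 <= \<epsilon> / 8\<close>, \<open>g / C2^2 <= \<epsilon> / 8\<close> and
    \<open>C2 >= 1\<close>.\<close>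
  define C2 where "C2 = 12 * dc * (exp 3 + 16 / \<epsilon>) + g * 8 / \<epsilon> + 1"
  \<comment> \<open>Brings the Markov bound at t = 1 down to \<open>\<epsilon> / 4\<close>, since
    \<open>r1 >= C3 s\<close>; the null error then totals \<open>\<epsilon> / 2\<close>.\<close>
  define C3 where "C3 = 2 * (fc + 2) / \<epsilon>"
  \<comment> \<open>The first summand lets the signal dominate thresholds and selection losses, with
    \<open>32 = 8 * 4\<close> from \<open>Q >= \<rho>^2 / 8\<close> and the bound
    \<open>Q / 4\<close>. The second makes the acceptance probability at most
    \<open>\<epsilon> / 2\<close>.\<close>
  define C4 where "C4 = 32 * (4 * C1\<^sup>2 + 1 + 2 * C2 + C3) + 32 * (fc + 8) / \<epsilon>"
  have g: "g > 0" using pos assms by (simp add: g_def add_pos_pos)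
  have C1: "C1 > 0" "C1\<^sup>2 = exp 2 * 4 powr (1 / \<alpha>) * sc"
    using pos by (simp_all add: C1_def)
  have C2_ge: "C2 \<ge> 12 * dc * exp 3" "C2 \<ge> 12 * dc * (16 / \<epsilon>)" "C2 \<ge> g * 8 / \<epsilon>" "C2 \<ge> 1"
    using pos g assms by (simp_all add: C2_def distrib_left)
  have C3: "C3 > 0" using pos assms by (simp add: C3_def)
  have C4: "C4 \<ge> 32 * (4 * C1\<^sup>2 + 1 + 2 * C2 + C3)" "C4 \<ge> 32 * (fc + 8) / \<epsilon>" "C4 > 0"
  proof -
    have "32 * (4 * C1\<^sup>2 + 1 + 2 * C2 + C3) > 0"
      using C1(1) C2_ge(4) C3 by (intro mult_pos_pos add_pos_pos zero_less_power) auto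
    moreover have "32 * (fc + 8) / \<epsilon> > 0"
      using pos assms by simp
    ultimately show "C4 \<ge> 32 * (4 * C1\<^sup>2 + 1 + 2 * C2 + C3)" "C4 \<ge> 32 * (fc + 8) / \<epsilon>" "C4 > 0"
      unfolding C4_def by linarith+
  qed
  have eta: "12 * dc / C2 \<le> exp (- 3)" "2 * (12 * dc / C2) \<le> \<epsilon> / 8"
    using C2_ge assms by (simp_all add: exp_minus field_simps)
  \<comment> \<open>\<open>C2 >= 1\<close> lets the lower bound on \<open>C2\<close> serve for its
    square.\<close>
  have "g * 8 / \<epsilon> \<le> C2 * C2"
    using C2_ge(3,4) mult_mono[of 1 C2 C2 C2] by linarith
  then have gC2: "g / C2\<^sup>2 \<le> \<epsilon> / 8"
    using C2_ge(4) assms by (simp add: power2_eq_square field_simps)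
  have main: "testing_error \<alpha> K p n s \<rho> (sparse_test p n a r r1) \<le> ennreal \<epsilon>"
    if n: "n \<ge> 2" and s: "s \<in> {1..p}"
      and L: "L = ln (exp 1 * real p / real s)" and l: "l = ln (ln (8 * real n))"
      and a: "a = C1 * (L powr (1 / \<alpha>) + real s powr (- 1 / 2) * l powr (1 / 2))"
      and r: "r = C2 * (sqrt (real s * l) + l)" and r1: "r1 = C3 * real s * L powr (2 / \<alpha>)"
      and \<rho>: "\<rho>\<^sup>2 \<ge> C4 * (real s * L powr (2 / \<alpha>) + l)"
    for n p s :: nat and \<rho> L l a r r1 :: real
  proof -
    have L1: "L \<ge> 1" unfolding L using log_ratio(1)[OF s] .
    have l1: "l \<ge> 1 / 2" unfolding l using iterated_log(1)[OF n] .
    have s1: "s \<ge> 1" using s by simp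
    define B where "B = real s * L powr (2 / \<alpha>) + l"
    have Lp: "L powr (2 / \<alpha>) \<ge> 1" using L1 assms by (intro ge_one_powr_ge_zero) auto
    then have Lp0: "L powr (2 / \<alpha>) > 0" by linarith
    have thr: "real s * (2 * a\<^sup>2 + 1) + r \<le> (4 * C1\<^sup>2 + 1 + 2 * C2 + C3) * B"
        "real s * (2 * a\<^sup>2 + 1) + r1 \<le> (4 * C1\<^sup>2 + 1 + 2 * C2 + C3) * B" "real s \<le> B"
      using threshold_bounds[of L l s "1 / \<alpha>" C1 C2 C3] L1 l1 s1 C1 C2_ge C3 assms
      by (simp_all add: B_def a r r1)
    have B: "B > 0" using thr(3) s1 by linarith
    have \<rho>B: "\<rho>\<^sup>2 \<ge> C4 * B" using \<rho> by (simp add: B_def)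
    then have \<rho>0: "\<rho>\<^sup>2 > 0" using mult_pos_pos[OF C4(3) B] by linarith
    have "(4 * C1\<^sup>2 + 1 + 2 * C2 + C3) * B \<le> C4 / 32 * B"
      using C4(1) B by (intro mult_right_mono) auto
    then have small: "(4 * C1\<^sup>2 + 1 + 2 * C2 + C3) * B \<le> \<rho>\<^sup>2 / 32" using \<rho>B by simp
    have a_ge: "a \<ge> C1 * L powr (1 / \<alpha>)"
      using C1(1) by (simp add: a)
    have r1_pos: "r1 > 0" using C3 s1 L1 by (simp add: r1)
    have null: "(\<integral>\<^sup>+X. ennreal (sparse_test p n a r r1 X) \<partial>data_law p n \<theta> P) \<le> ennreal (\<epsilon> / 2)"
      if P: "P \<in> noise_laws \<alpha> K p n" and \<theta>: "\<theta> \<in> null_params p n" for P \<theta>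
    proof -
      interpret noise_model \<alpha> K p n s P a C1
        using assms n s P C1 a_ge L by unfold_locales (auto simp: sc_def G_def)
      have "(\<integral>\<^sup>+X. ennreal (sparse_test p n a r r1 X) \<partial>data_law p n \<theta> P) \<le>
          ennreal (g / C2\<^sup>2 + 2 * (12 * dc / C2) + (fc + 2) / 2 * real s / r1)"
        using null_error[OF \<theta>, of C2 r r1] C2_ge(4) eta(1) r1_pos
        by (simp add: r l l_def g_def fc_def dc_def G_def)
      also have "\<dots> \<le> ennreal (\<epsilon> / 2)"
      proof (rule ennreal_leI)
        have "(fc + 2) / 2 * real s / r1 = (fc + 2) / 2 / (C3 * L powr (2 / \<alpha>))"
          using s1 by (simp add: r1)
        also have "\<dots> \<le> (fc + 2) / 2 / (C3 * 1)"
          using C3 pos Lp Lp0 by (intro divide_left_mono mult_left_mono) auto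
        also have "\<dots> = \<epsilon> / 4"
          using pos assms by (simp add: C3_def field_simps)
        finally show "g / C2\<^sup>2 + 2 * (12 * dc / C2) + (fc + 2) / 2 * real s / r1 \<le> \<epsilon> / 2"
          using gC2 eta(2) by linarith
      qed
      finally show ?thesis .
    qed
    have alt: "(\<integral>\<^sup>+X. ennreal (1 - sparse_test p n a r r1 X) \<partial>data_law p n \<theta> P) \<le> ennreal (\<epsilon> / 2)"
      if P: "P \<in> noise_laws \<alpha> K p n" and \<theta>: "\<theta> \<in> alt_params p n s \<rho>" for P \<theta>
    proof -
      interpret noise_model \<alpha> K p n s P a C1
        using assms n s P C1 a_ge L by unfold_locales (auto simp: sc_def G_def)
      have "(\<integral>\<^sup>+X. ennreal (1 - sparse_test p n a r r1 X) \<partial>data_law p n \<theta> P) \<le>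
          ennreal (4 * ((fc + 8) / 2 * real s) / (\<rho>\<^sup>2 / 8))"
        unfolding fc_def G_def
        using alt_error[OF \<theta> \<rho>0 order_trans[OF thr(1) small] order_trans[OF thr(2) small]] .
      also have "\<dots> \<le> ennreal (\<epsilon> / 2)"
      proof (rule ennreal_leI)
        have "32 * (fc + 8) * real s \<le> (C4 * \<epsilon>) * B"
        proof (rule mult_mono)
          show "32 * (fc + 8) \<le> C4 * \<epsilon>"
            using C4(2) assms by (simp add: field_simps)
        qed (use thr(3) C4(3) assms in auto)
        also have "\<dots> = \<epsilon> * (C4 * B)" by simp
        also have "\<dots> \<le> \<epsilon> * \<rho>\<^sup>2" using \<rho>B assms by (intro mult_left_mono) auto
        finally show "4 * ((fc + 8) / 2 * real s) / (\<rho>\<^sup>2 / 8) \<le> \<epsilon> / 2"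
          using \<rho>0 by (simp add: field_simps)
      qed
      finally show ?thesis .
    qed
    \<comment> \<open>The bounds are uniform over laws and parameters, so they pass to both suprema;
      an empty noise class is covered as well.\<close>
    have "testing_error \<alpha> K p n s \<rho> (sparse_test p n a r r1) \<le> ennreal (\<epsilon> / 2) + ennreal (\<epsilon> / 2)"
      unfolding testing_error_def using null alt by (intro add_mono SUP_least)
    also have "\<dots> = ennreal \<epsilon>"
      using assms by (simp flip: ennreal_plus)
    finally show ?thesis .
  qed
  show ?thesis
  proof (rule exI[of _ C1], rule exI[of _ C2], rule exI[of _ C3], rule exI[of _ C4], intro conjI allI impI)
    fix n p s :: nat and \<rho> :: real
    assume n: "n \<ge> 2" and s: "s \<in> {1..p}"
    show "let L = ln (exp 1 * real p / real s);
           a = C1 * (L powr (1 / \<alpha>) + real s powr (- 1 / 2) * ln (ln (8 * real n)) powr (1 / 2));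
           r = C2 * (sqrt (real s * ln (ln (8 * real n))) + ln (ln (8 * real n)));
           r1 = C3 * real s * L powr (2 / \<alpha>)
       in \<rho>\<^sup>2 \<ge> C4 * (real s * L powr (2 / \<alpha>) + ln (ln (8 * real n))) \<longrightarrow>
          testing_error \<alpha> K p n s \<rho> (sparse_test p n a r r1) \<le> ennreal \<epsilon>"
      unfolding Let_def by (intro impI main[OF n s refl refl refl refl refl])
  qed (use C1 C2_ge C3 C4 in auto)
qed

end
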